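(* Let $n\ge 3$ and let $(M,g)$ be an $n$-dimensional Riemannian manifold which admits $n$ orthogonal limiting Carleman weights. Then $(M,g)$ is conformally flat.
   Context: Limiting Carleman weight (LCW): a real-valued $\varphi\in C^\infty(M)$ on a Riemannian manifold $(M,g)$ of dimension $n\geq 3$ with $d\varphi\neq0$ everywhere and such that $\mathrm{Hess}_g\varphi(\nabla\varphi,\nabla\varphi)+\mathrm{Hess}_g\varphi(V,V)=0$ at every point $p$ and for every $V\in T_pM$ with $|V|=|\nabla\varphi|$, $\langle V,\nabla\varphi\rangle=0$. Equivalently, $d\varphi\ne0$ everywhere and $|\nabla\varphi|^{-2}\nabla\varphi$ is a conformal Killing vector field. LCWs $\varphi_1,\dots,\varphi_m$ are orthogonal if their gradients are pairwise orthogonal at each point. Conformally flat means that every point has a neighbourhood on which some metric $cg$, with $c$ a smooth positive function, is flat. *)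

theory Defs
  imports "HOL-Analysis.Analysis"
begin

section \<open>Smooth maps between open subsets of Euclidean spaces\<close>

text \<open>All notions in this section are used for open sets \<open>S\<close> only, so that the values
  of \<open>f\<close> outside \<open>S\<close> are irrelevant.\<close>

fun Ck_on :: "nat \<Rightarrow> 'a::euclidean_space set \<Rightarrow> ('a \<Rightarrow> 'b::real_normed_vector) \<Rightarrow> bool" where
  "Ck_on 0 S f \<longleftrightarrow> continuous_on S f"
| "Ck_on (Suc k) S f \<longleftrightarrow>
     (\<forall>u\<in>S. f differentiable (at u)) \<and>
     (\<forall>a. Ck_on k S (\<lambda>u. frechet_derivative f (at u) a))"

definition smooth_on :: "'a::euclidean_space set \<Rightarrow> ('a \<Rightarrow> 'b::real_normed_vector) \<Rightarrow> bool" where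
  "smooth_on S f \<longleftrightarrow> (\<forall>k. Ck_on k S f)"

definition pderiv_at :: "'n::finite \<Rightarrow> (real ^ 'n \<Rightarrow> real) \<Rightarrow> real ^ 'n \<Rightarrow> real" where
  "pderiv_at i F u = frechet_derivative F (at u) (axis i 1)"


section \<open>Smooth manifolds\<close>

text \<open>A chart \<open>(U, x)\<close> consists of its domain and its coordinate map; the values of \<open>x\<close>
  outside \<open>U\<close> are irrelevant. The dimension of the manifold is \<open>CARD('n)\<close>.\<close>

type_synonym ('a, 'n) chart = "'a set \<times> ('a \<Rightarrow> real ^ 'n)"

abbreviation dom_of :: "('a, 'n::finite) chart \<Rightarrow> 'a set" where
  "dom_of c \<equiv> fst c"

abbreviation coord :: "('a, 'n::finite) chart \<Rightarrow> 'a \<Rightarrow> real ^ 'n" where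
  "coord c \<equiv> snd c"

definition coord_inv :: "('a, 'n::finite) chart \<Rightarrow> real ^ 'n \<Rightarrow> 'a" where
  "coord_inv c = inv_into (dom_of c) (coord c)"

definition is_chart :: "'a topology \<Rightarrow> ('a, 'n::finite) chart \<Rightarrow> bool" where
  "is_chart T c \<longleftrightarrow>
     openin T (dom_of c) \<and> open (coord c ` dom_of c) \<and>
     homeomorphic_map (subtopology T (dom_of c)) (top_of_set (coord c ` dom_of c)) (coord c)"

definition transition :: "('a, 'n::finite) chart \<Rightarrow> ('a, 'n) chart \<Rightarrow> real ^ 'n \<Rightarrow> real ^ 'n" where
  "transition c d = coord d \<circ> coord_inv c"

definition compatible :: "('a, 'n::finite) chart \<Rightarrow> ('a, 'n) chart \<Rightarrow> bool" where
  "compatible c d \<longleftrightarrow>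
     smooth_on (coord c ` (dom_of c \<inter> dom_of d)) (transition c d) \<and>
     smooth_on (coord d ` (dom_of c \<inter> dom_of d)) (transition d c)"

text \<open>The smooth structure is a maximal atlas, so \<open>A\<close> contains every smooth chart. In particular,
  the diffeomorphisms from open subsets of the manifold onto open subsets of Euclidean space
  are exactly the elements of \<open>A\<close>.\<close>

definition smooth_manifold :: "'a topology \<Rightarrow> ('a, 'n::finite) chart set \<Rightarrow> bool" where
  "smooth_manifold T A \<longleftrightarrow>
     Hausdorff_space T \<and> second_countable T \<and>
     (\<forall>c\<in>A. is_chart T c) \<and>
     (\<Union>c\<in>A. dom_of c) = topspace T \<and>
     (\<forall>c\<in>A. \<forall>d\<in>A. compatible c d) \<and>
     (\<forall>c. is_chart T c \<and> (\<forall>d\<in>A. compatible c d) \<longrightarrow> c \<in> A)"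

definition smooth_fun_on :: "('a, 'n::finite) chart set \<Rightarrow> 'a set \<Rightarrow> ('a \<Rightarrow> real) \<Rightarrow> bool" where
  "smooth_fun_on A W f \<longleftrightarrow>
     (\<forall>c\<in>A. smooth_on (coord c ` (dom_of c \<inter> W)) (f \<circ> coord_inv c))"

text \<open>An arbitrarily chosen chart around \<open>p\<close>, in which tensorial expressions at \<open>p\<close> are evaluated.
  The differential and the Hessian below do not depend on this choice.\<close>

definition chart_at :: "('a, 'n::finite) chart set \<Rightarrow> 'a \<Rightarrow> ('a, 'n) chart" where
  "chart_at A p = (SOME c. c \<in> A \<and> p \<in> dom_of c)"


section \<open>Tangent vectors\<close>

text \<open>A tangent vector at \<open>p\<close> assigns to every chart \<open>c\<close> around \<open>p\<close> a vector of components \<open>v c\<close>, and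
  components with respect to different charts are related by the derivative of the transition map.
  Thus \<open>v c\<close> is the image of \<open>v\<close> under the differential of the coordinate map of \<open>c\<close>.
  The value \<open>0\<close> at all other \<open>c\<close> makes equality of tangent vectors equality of functions;
  the vector space operations are pointwise.\<close>

type_synonym ('a, 'n) tvec = "('a, 'n) chart \<Rightarrow> real ^ 'n"

definition tangent_space :: "('a, 'n::finite) chart set \<Rightarrow> 'a \<Rightarrow> ('a, 'n) tvec set" where
  "tangent_space A p = {v.
     (\<forall>c\<in>A. \<forall>d\<in>A. p \<in> dom_of c \<and> p \<in> dom_of d \<longrightarrow>
        v d = frechet_derivative (transition c d) (at (coord c p)) (v c)) \<and>
     (\<forall>c. \<not> (c \<in> A \<and> p \<in> dom_of c) \<longrightarrow> v c = 0)}"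

text \<open>The coordinate vector field \<open>\<partial>/\<partial>x\<^sub>i\<close> of the chart \<open>c\<close> at the point \<open>p\<close>.\<close>

definition coord_vec :: "('a, 'n::finite) chart set \<Rightarrow> ('a, 'n) chart \<Rightarrow> 'n \<Rightarrow> 'a \<Rightarrow> ('a, 'n) tvec" where
  "coord_vec A c i p = (\<lambda>d.
     if d \<in> A \<and> p \<in> dom_of d
     then frechet_derivative (transition c d) (at (coord c p)) (axis i 1) else 0)"

definition differential ::
  "('a, 'n::finite) chart set \<Rightarrow> ('a \<Rightarrow> real) \<Rightarrow> 'a \<Rightarrow> ('a, 'n) tvec \<Rightarrow> real" where
  "differential A f p v =
     (let c = chart_at A p
      in frechet_derivative (f \<circ> coord_inv c) (at (coord c p)) (v c))"


section \<open>Riemannian metrics\<close>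

type_synonym ('a, 'n) metric = "'a \<Rightarrow> ('a, 'n) tvec \<Rightarrow> ('a, 'n) tvec \<Rightarrow> real"

definition metric_comp ::
  "('a, 'n::finite) chart set \<Rightarrow> ('a, 'n) metric \<Rightarrow> ('a, 'n) chart \<Rightarrow> 'n \<Rightarrow> 'n \<Rightarrow> real ^ 'n \<Rightarrow> real" where
  "metric_comp A g c i j u =
     g (coord_inv c u) (coord_vec A c i (coord_inv c u)) (coord_vec A c j (coord_inv c u))"

definition riemannian_metric ::
  "'a topology \<Rightarrow> ('a, 'n::finite) chart set \<Rightarrow> ('a, 'n) metric \<Rightarrow> bool" where
  "riemannian_metric T A g \<longleftrightarrow>
     (\<forall>p\<in>topspace T.
        (\<forall>v\<in>tangent_space A p. \<forall>w\<in>tangent_space A p. g p v w = g p w v) \<and>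
        (\<forall>v\<in>tangent_space A p. \<forall>v'\<in>tangent_space A p. \<forall>w\<in>tangent_space A p. \<forall>a b.
           g p (\<lambda>c. a *\<^sub>R v c + b *\<^sub>R v' c) w = a * g p v w + b * g p v' w) \<and>
        (\<forall>v\<in>tangent_space A p. v \<noteq> (\<lambda>c. 0) \<longrightarrow> g p v v > 0)) \<and>
     (\<forall>c\<in>A. \<forall>i j. smooth_on (coord c ` dom_of c) (metric_comp A g c i j))"

definition riemannian_manifold ::
  "'a topology \<Rightarrow> ('a, 'n::finite) chart set \<Rightarrow> ('a, 'n) metric \<Rightarrow> bool" where
  "riemannian_manifold T A g \<longleftrightarrow> smooth_manifold T A \<and> riemannian_metric T A g"

definition tnorm :: "('a, 'n::finite) metric \<Rightarrow> 'a \<Rightarrow> ('a, 'n) tvec \<Rightarrow> real" where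
  "tnorm g p v = sqrt (g p v v)"

definition gradient ::
  "('a, 'n::finite) chart set \<Rightarrow> ('a, 'n) metric \<Rightarrow> ('a \<Rightarrow> real) \<Rightarrow> 'a \<Rightarrow> ('a, 'n) tvec" where
  "gradient A g f p =
     (THE v. v \<in> tangent_space A p \<and> (\<forall>w\<in>tangent_space A p. g p v w = differential A f p w))"

text \<open>\<open>christoffel A g c k i j\<close> is the Christoffel symbol \<open>\<Gamma>\<close> of the Levi-Civita connection with upper
  index \<open>k\<close> and lower indices \<open>i\<close>, \<open>j\<close>, as a function on the image of the chart \<open>c\<close>.\<close>

definition christoffel ::
  "('a, 'n::finite) chart set \<Rightarrow> ('a, 'n) metric \<Rightarrow> ('a, 'n) chart \<Rightarrow> 'n \<Rightarrow> 'n \<Rightarrow> 'n \<Rightarrow> real ^ 'n \<Rightarrow> real"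
  where
  "christoffel A g c k i j u =
     (let ginv = matrix_inv (\<chi> a b. metric_comp A g c a b u)
      in 1/2 * (\<Sum>l\<in>UNIV. ginv $ k $ l *
           (pderiv_at i (metric_comp A g c j l) u
            + pderiv_at j (metric_comp A g c i l) u
            - pderiv_at l (metric_comp A g c i j) u)))"

text \<open>The covariant Hessian \<open>Hess f = \<nabla>df\<close> of a function, with components
  \<open>\<partial>\<^sub>i\<partial>\<^sub>j f - (\<Sum>k. \<Gamma>\<^sup>k\<^sub>i\<^sub>j \<partial>\<^sub>k f)\<close>.\<close>

definition hessian ::
  "('a, 'n::finite) chart set \<Rightarrow> ('a, 'n) metric \<Rightarrow> ('a \<Rightarrow> real) \<Rightarrow> 'a
     \<Rightarrow> ('a, 'n) tvec \<Rightarrow> ('a, 'n) tvec \<Rightarrow> real" where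
  "hessian A g f p v w =
     (let c = chart_at A p; F = f \<circ> coord_inv c; u = coord c p
      in \<Sum>i\<in>UNIV. \<Sum>j\<in>UNIV.
           (pderiv_at i (pderiv_at j F) u - (\<Sum>k\<in>UNIV. christoffel A g c k i j u * pderiv_at k F u))
           * (v c $ i) * (w c $ j))"


section \<open>Limiting Carleman weights\<close>

definition limiting_carleman_weight ::
  "'a topology \<Rightarrow> ('a, 'n::finite) chart set \<Rightarrow> ('a, 'n) metric \<Rightarrow> ('a \<Rightarrow> real) \<Rightarrow> bool" where
  "limiting_carleman_weight T A g f \<longleftrightarrow>
     smooth_fun_on A (topspace T) f \<and>
     (\<forall>p\<in>topspace T. \<exists>v\<in>tangent_space A p. differential A f p v \<noteq> 0) \<and>
     (\<forall>p\<in>topspace T. \<forall>v\<in>tangent_space A p.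
        tnorm g p v = tnorm g p (gradient A g f p) \<and> g p v (gradient A g f p) = 0 \<longrightarrow>
        hessian A g f p (gradient A g f p) (gradient A g f p) + hessian A g f p v v = 0)"

definition orthogonal_LCWs ::
  "'a topology \<Rightarrow> ('a, 'n::finite) chart set \<Rightarrow> ('a, 'n) metric \<Rightarrow> ('i \<Rightarrow> 'a \<Rightarrow> real) \<Rightarrow> bool" where
  "orthogonal_LCWs T A g \<phi> \<longleftrightarrow>
     (\<forall>i. limiting_carleman_weight T A g (\<phi> i)) \<and>
     (\<forall>i j. i \<noteq> j \<longrightarrow>
        (\<forall>p\<in>topspace T. g p (gradient A g (\<phi> i) p) (gradient A g (\<phi> j) p) = 0))"


section \<open>Conformal flatness\<close>

text \<open>Flatness on an open set \<open>W\<close> means being locally isometric to Euclidean space: since \<open>v c\<close> is the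
  image of \<open>v\<close> under the differential of the chart \<open>c\<close>, the condition below says that \<open>c\<close>
  is an isometry onto an open subset of \<open>real ^ 'n\<close> with its standard metric.\<close>

definition flat_on :: "('a, 'n::finite) chart set \<Rightarrow> ('a, 'n) metric \<Rightarrow> 'a set \<Rightarrow> bool" where
  "flat_on A g W \<longleftrightarrow>
     (\<forall>p\<in>W. \<exists>c\<in>A. p \<in> dom_of c \<and> dom_of c \<subseteq> W \<and>
        (\<forall>q\<in>dom_of c. \<forall>v\<in>tangent_space A q. \<forall>w\<in>tangent_space A q. g q v w = v c \<bullet> w c))"

definition conformally_flat ::
  "'a topology \<Rightarrow> ('a, 'n::finite) chart set \<Rightarrow> ('a, 'n) metric \<Rightarrow> bool" where
  "conformally_flat T A g \<longleftrightarrow>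
     (\<forall>p\<in>topspace T. \<exists>W \<rho>. openin T W \<and> p \<in> W \<and> smooth_fun_on A W \<rho> \<and> (\<forall>q\<in>W. \<rho> q > 0) \<and>
        flat_on A (\<lambda>q v w. \<rho> q * g q v w) W)"

end

theory Submission
  imports Defs
begin

text \<open>Up to constant factors, the weights themselves are local coordinates in which a conformal multiple
  of \<open>g\<close> is Euclidean. Let \<open>\<phi>\<^sub>1, \<dots>, \<phi>\<^sub>n\<close> be the weights and \<open>N\<^sub>i = |\<nabla>\<phi>\<^sub>i|\<^sup>2\<close>. The gradients are nonzero and
  orthogonal, and there are as many of them as dimensions, so they form an orthogonal frame and
  \<open>g = \<Sum>\<^sub>i d\<phi>\<^sub>i\<^sup>2 / N\<^sub>i\<close> (\<open>metric_eq_sum_differentials\<close>). If all quotients \<open>N\<^sub>i / N\<^sub>j\<close> are locally constant, then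
  for any fixed \<open>m\<close> the metric \<open>N\<^sub>m g = \<Sum>\<^sub>i (N\<^sub>m / N\<^sub>i) d\<phi>\<^sub>i\<^sup>2\<close> is Euclidean in the coordinates
  \<open>sqrt (N\<^sub>m / N\<^sub>i) \<phi>\<^sub>i\<close>. These are coordinates by the inverse function theorem in its smooth form
  (\<open>smooth_local_inverse\<close>), and they form a chart of the given atlas because it is maximal
  (\<open>chart_reparametrize\<close>).

  That the quotients are locally constant is the geometric content. In terms of conformal Killing
  fields: in the coordinates \<open>\<phi>\<^sub>i\<close> the fields \<open>\<nabla>\<phi>\<^sub>i / N\<^sub>i\<close> are the coordinate fields \<open>\<partial>\<^sub>i\<close>, and a diagonal metric for
  which each \<open>\<partial>\<^sub>i\<close> is conformal Killing has diagonal entries with constant quotients. The proof works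
  directly with the Hessian instead. The product rule
  \<open>w \<langle>\<nabla>f, \<nabla>h\<rangle> = Hess f (w, \<nabla>h) + Hess h (w, \<nabla>f)\<close> (\<open>metric_gradients_has_derivative\<close>) is applied to
  \<open>\<langle>\<nabla>\<phi>\<^sub>i, \<nabla>\<phi>\<^sub>k\<rangle> = 0\<close> and to \<open>\<langle>\<nabla>\<phi>\<^sub>i, \<nabla>\<phi>\<^sub>i\<rangle> = N\<^sub>i\<close>; together with the symmetry of the Hessian and the Carleman
  condition for multiples of the \<open>\<nabla>\<phi>\<^sub>k\<close> it shows that \<open>d (ln N\<^sub>i)\<close> takes the value
  \<open>2 Hess \<phi>\<^sub>k (\<nabla>\<phi>\<^sub>k, \<nabla>\<phi>\<^sub>k) / N\<^sub>k\<close> on \<open>\<nabla>\<phi>\<^sub>k\<close>, which does not depend on \<open>i\<close> (\<open>grad_sq_ratio_stationary\<close>).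

  The Hessian at a point is evaluated in a chart chosen for that point. Only the conclusion that a
  quotient \<open>N\<^sub>i / N\<^sub>j\<close> is stationary at the point has to be transferred to other charts, and for this the
  chain rule suffices (\<open>grad_sq_ratio_stationary_chart\<close>).\<close>


section \<open>Calculus of smooth maps between Euclidean spaces\<close>

lemma frechet_derivative_cong_open:
  assumes "open S" "u \<in> S" "\<And>x. x \<in> S \<Longrightarrow> f x = g x"
  shows "frechet_derivative f (at u) = frechet_derivative g (at u)"
proof -
  have "(f has_derivative f') (at u) \<longleftrightarrow> (g has_derivative f') (at u)" for f'
    using has_derivative_transform_within_open[OF _ assms(1,2)] assms(3) by metis
  then show ?thesis
    unfolding frechet_derivative_def by simp
qed

lemma Ck_on_subset: "Ck_on k S f \<Longrightarrow> S' \<subseteq> S \<Longrightarrow> Ck_on k S' f"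
  by (induction k arbitrary: f) (auto intro: continuous_on_subset)

lemma Ck_on_SucD: "Ck_on (Suc k) S f \<Longrightarrow> Ck_on k S f"
proof (induction k arbitrary: f)
  case 0
  then show ?case
    by (auto intro!: continuous_at_imp_continuous_on differentiable_imp_continuous_within)
next
  case (Suc k)
  then show ?case
    by (metis Ck_on.simps(2))
qed

lemma Ck_on_cong:
  assumes "open S" "Ck_on k S f" "\<And>x. x \<in> S \<Longrightarrow> f x = g x"
  shows "Ck_on k S g"
  using assms(2,3)
proof (induction k arbitrary: f g)
  case 0
  then show ?case by (simp cong: continuous_on_cong)
next
  case (Suc k)
  have D: "frechet_derivative f (at u) = frechet_derivative g (at u)" if "u \<in> S" for u
    using frechet_derivative_cong_open[OF assms(1) that Suc.prems(2)] .
  have "g differentiable (at u)" if "u \<in> S" for u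
    using Suc.prems that has_derivative_transform_within_open[OF _ assms(1) that]
    unfolding differentiable_def by (metis Ck_on.simps(2) frechet_derivative_works)
  moreover have "Ck_on k S (\<lambda>u. frechet_derivative g (at u) a)" for a
    by (rule Suc.IH[of "\<lambda>u. frechet_derivative f (at u) a"]) (use Suc.prems D in auto)
  ultimately show ?case by auto
qed

text \<open>Any pointwise derivative may be used to verify \<open>C\<^sup>k\<^sup>+\<^sup>1\<close>; this spares every closure property below from
  computing with \<^const>\<open>frechet_derivative\<close>.\<close>

lemma Ck_on_SucI:
  assumes "open S" "\<And>u. u \<in> S \<Longrightarrow> (f has_derivative f' u) (at u)"
    "\<And>a. Ck_on k S (\<lambda>u. f' u a)"
  shows "Ck_on (Suc k) S f"
proof -
  have "Ck_on k S (\<lambda>u. frechet_derivative f (at u) a)" for a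
    by (rule Ck_on_cong[OF assms(1) assms(3)[of a]]) (metis assms(2) frechet_derivative_at)
  moreover have "f differentiable (at u)" if "u \<in> S" for u
    using assms(2)[OF that] by (auto simp: differentiable_def)
  ultimately show ?thesis by auto
qed

lemma Ck_on_Suc_has_derivative:
  assumes "Ck_on (Suc k) S f" "u \<in> S"
  shows "(f has_derivative frechet_derivative f (at u)) (at u)"
  using assms frechet_derivative_works by auto

lemma Ck_on_const: "open S \<Longrightarrow> Ck_on k S (\<lambda>u. c)"
  by (induction k arbitrary: c) (auto intro!: Ck_on_SucI[where f' = "\<lambda>u a. 0"] derivative_eq_intros)

lemma Ck_on_add:
  assumes "open S" "Ck_on k S f" "Ck_on k S g"
  shows "Ck_on k S (\<lambda>u. f u + g u)"
  using assms(2,3)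
proof (induction k arbitrary: f g)
  case 0
  then show ?case by (auto intro: continuous_on_add)
next
  case (Suc k)
  show ?case
    by (rule Ck_on_SucI[where f' = "\<lambda>u a. frechet_derivative f (at u) a + frechet_derivative g (at u) a"])
      (use assms(1) Suc in \<open>auto intro!: has_derivative_add Ck_on_Suc_has_derivative\<close>)
qed

lemma Ck_on_bilinear:
  assumes "open S" "bounded_bilinear (\<lambda>x y. h x y)" "Ck_on k S f" "Ck_on k S g"
  shows "Ck_on k S (\<lambda>u. h (f u) (g u))"
  using assms(3,4)
proof (induction k arbitrary: f g)
  case 0
  then show ?case using bounded_bilinear.continuous_on[OF assms(2)] by auto
next
  case (Suc k)
  show ?case
  proof (rule Ck_on_SucI[OF assms(1)])
    show "((\<lambda>u. h (f u) (g u)) has_derivative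
        (\<lambda>a. h (f u) (frechet_derivative g (at u) a) + h (frechet_derivative f (at u) a) (g u))) (at u)"
      if "u \<in> S" for u
      by (intro bounded_bilinear.FDERIV[OF assms(2)] Ck_on_Suc_has_derivative[OF Suc.prems(1) that]
          Ck_on_Suc_has_derivative[OF Suc.prems(2) that])
    show "Ck_on k S (\<lambda>u. h (f u) (frechet_derivative g (at u) a) + h (frechet_derivative f (at u) a) (g u))"
      for a
      using Suc.prems by (intro Ck_on_add Suc.IH assms(1) Ck_on_SucD[OF Suc.prems(1)] Ck_on_SucD[OF Suc.prems(2)])
        auto
  qed
qed

lemma Ck_on_mult:
  fixes f g :: "'a::euclidean_space \<Rightarrow> real"
  shows "open S \<Longrightarrow> Ck_on k S f \<Longrightarrow> Ck_on k S g \<Longrightarrow> Ck_on k S (\<lambda>u. f u * g u)"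
  by (rule Ck_on_bilinear[OF _ bounded_bilinear_mult])

lemma Ck_on_cmult:
  fixes f :: "'a::euclidean_space \<Rightarrow> real"
  shows "open S \<Longrightarrow> Ck_on k S f \<Longrightarrow> Ck_on k S (\<lambda>u. c * f u)"
  by (intro Ck_on_mult Ck_on_const)

lemma Ck_on_sum:
  assumes "open S" "\<And>i. i \<in> I \<Longrightarrow> Ck_on k S (f i)"
  shows "Ck_on k S (\<lambda>u. \<Sum>i\<in>I. f i u)"
  using assms by (induction I rule: infinite_finite_induct) (auto intro: Ck_on_const Ck_on_add)

lemma Ck_on_prod:
  fixes f :: "'i \<Rightarrow> 'a::euclidean_space \<Rightarrow> real"
  assumes "open S" "\<And>i. i \<in> I \<Longrightarrow> Ck_on k S (f i)"
  shows "Ck_on k S (\<lambda>u. \<Prod>i\<in>I. f i u)"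
  using assms by (induction I rule: infinite_finite_induct) (auto intro: Ck_on_const Ck_on_mult)

lemma Ck_on_linear_compose:
  assumes "open S" "bounded_linear h" "Ck_on k S f"
  shows "Ck_on k S (\<lambda>u. h (f u))"
  using assms(3)
proof (induction k arbitrary: f)
  case 0
  then show ?case using assms(2) linear_continuous_on
    by (auto intro: bounded_linear.continuous_on)
next
  case (Suc k)
  show ?case
    by (rule Ck_on_SucI[where f' = "\<lambda>u a. h (frechet_derivative f (at u) a)"])
      (use assms(1) Suc in \<open>auto intro!: bounded_linear.has_derivative[OF assms(2)] Ck_on_Suc_has_derivative\<close>)
qed

lemma Ck_on_inverse:
  fixes f :: "'a::euclidean_space \<Rightarrow> real"
  assumes "open S" "Ck_on k S f" "\<And>u. u \<in> S \<Longrightarrow> f u \<noteq> 0"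
  shows "Ck_on k S (\<lambda>u. inverse (f u))"
  using assms(2)
proof (induction k)
  case 0
  then show ?case using assms(3) by (auto intro: continuous_on_inverse)
next
  case (Suc k)
  show ?case
  proof (rule Ck_on_SucI[OF assms(1)])
    show "((\<lambda>u. inverse (f u)) has_derivative
        (\<lambda>a. - (inverse (f u) * frechet_derivative f (at u) a * inverse (f u)))) (at u)" if "u \<in> S" for u
      using assms(3)[OF that] Ck_on_Suc_has_derivative[OF Suc.prems that] by (intro Deriv.has_derivative_inverse)
    have "Ck_on k S (\<lambda>u. - 1 * (inverse (f u) * frechet_derivative f (at u) a * inverse (f u)))" for a
      using Suc.prems by (intro Ck_on_mult Ck_on_const assms(1) Suc.IH Ck_on_SucD[OF Suc.prems]) auto
    then show "Ck_on k S (\<lambda>u. - (inverse (f u) * frechet_derivative f (at u) a * inverse (f u)))" for a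
      by simp
  qed
qed

lemma Ck_on_divide:
  fixes f :: "'a::euclidean_space \<Rightarrow> real"
  assumes "open S" "Ck_on k S f" "Ck_on k S g" "\<And>u. u \<in> S \<Longrightarrow> g u \<noteq> 0"
  shows "Ck_on k S (\<lambda>u. f u / g u)"
  unfolding divide_inverse using assms by (intro Ck_on_mult Ck_on_inverse)

text \<open>The chain rule writes the derivative of \<open>g \<circ> f\<close> as a sum of products of components of \<open>Df\<close> with
  functions of the same form \<open>h \<circ> f\<close>, where \<open>h\<close> is a directional derivative of \<open>g\<close>. Hence the induction
  on \<open>k\<close> has to be over all \<open>g\<close>.\<close>

lemma Ck_on_compose:
  fixes g :: "'b::euclidean_space \<Rightarrow> 'c::real_normed_vector"
  assumes S: "open S" "open R" and f: "Ck_on k S f" "f ` S \<subseteq> R" and g: "Ck_on k R g"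
  shows "Ck_on k S (\<lambda>u. g (f u))"
  using f(1) g
proof (induction k arbitrary: g)
  case 0
  then show ?case using f(2) continuous_on_compose2[of R g S f] by auto
next
  case (Suc k)
  have chain: "((\<lambda>u. g (f u)) has_derivative
      (\<lambda>a. \<Sum>b\<in>Basis. (frechet_derivative f (at u) a \<bullet> b) *\<^sub>R frechet_derivative g (at (f u)) b)) (at u)"
    if "u \<in> S" for u
  proof -
    have dg: "(g has_derivative frechet_derivative g (at (f u))) (at (f u))"
      using Suc.prems(2) f(2) that by (intro Ck_on_Suc_has_derivative) auto
    have eq: "frechet_derivative g (at (f u)) w
        = (\<Sum>b\<in>Basis. (w \<bullet> b) *\<^sub>R frechet_derivative g (at (f u)) b)" for w
    proof -
      have "linear (frechet_derivative g (at (f u)))" using dg by (rule has_derivative_linear)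
      then show ?thesis
        by (subst euclidean_representation[symmetric, of w]) (simp only: linear_sum linear_cmul)
    qed
    show ?thesis
      using has_derivative_compose[OF Ck_on_Suc_has_derivative[OF Suc.prems(1) that] dg]
      by (subst (asm) eq)
  qed
  have "Ck_on k S (\<lambda>u. frechet_derivative g (at (f u)) b)" for b
    using Suc.prems by (intro Suc.IH Ck_on_SucD[OF Suc.prems(1)]) auto
  moreover have "Ck_on k S (\<lambda>u. frechet_derivative f (at u) a \<bullet> b)" for a b
    using Suc.prems(1) by (intro Ck_on_linear_compose[OF S(1) bounded_linear_inner_left]) auto
  ultimately show ?case
    by (intro Ck_on_SucI[OF S(1) chain] Ck_on_sum Ck_on_bilinear[OF _ bounded_bilinear_scaleR] S(1))
qed

lemma Ck_on_vec_iff: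
  fixes f :: "'a::euclidean_space \<Rightarrow> real ^ 'n::finite"
  assumes S: "open S"
  shows "Ck_on k S f \<longleftrightarrow> (\<forall>i. Ck_on k S (\<lambda>u. f u $ i))"
proof
  show "\<forall>i. Ck_on k S (\<lambda>u. f u $ i)" if "Ck_on k S f"
    using that by (intro allI Ck_on_linear_compose[OF S bounded_linear_vec_nth])
next
  assume *: "\<forall>i. Ck_on k S (\<lambda>u. f u $ i)"
  have "f = (\<lambda>u. \<Sum>i\<in>UNIV. (f u $ i) *\<^sub>R axis i 1)"
    by (rule ext) (metis (no_types, lifting) basis_expansion scalar_mult_eq_scaleR sum.cong)
  moreover have "Ck_on k S (\<lambda>u. \<Sum>i\<in>UNIV. (f u $ i) *\<^sub>R (axis i 1 :: real ^ 'n))"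
    using * by (intro Ck_on_sum Ck_on_bilinear[OF _ bounded_bilinear_scaleR] Ck_on_const S) auto
  ultimately show "Ck_on k S f" by simp
qed

lemma smooth_on_vec_iff:
  fixes f :: "'a::euclidean_space \<Rightarrow> real ^ 'n::finite"
  assumes "open S"
  shows "smooth_on S f \<longleftrightarrow> (\<forall>i. smooth_on S (\<lambda>u. f u $ i))"
  unfolding smooth_on_def Ck_on_vec_iff[OF assms] by auto

lemma smooth_on_subset: "smooth_on S f \<Longrightarrow> S' \<subseteq> S \<Longrightarrow> smooth_on S' f"
  unfolding smooth_on_def using Ck_on_subset by blast

lemma smooth_on_cong:
  "open S \<Longrightarrow> smooth_on S f \<Longrightarrow> (\<And>x. x \<in> S \<Longrightarrow> f x = g x) \<Longrightarrow> smooth_on S g"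
  unfolding smooth_on_def using Ck_on_cong by metis

lemma smooth_on_compose:
  fixes g :: "'b::euclidean_space \<Rightarrow> 'c::real_normed_vector"
  assumes "open S" "open R" "smooth_on S f" "f ` S \<subseteq> R" "smooth_on R g"
  shows "smooth_on S (\<lambda>u. g (f u))"
  using assms unfolding smooth_on_def by (auto intro: Ck_on_compose)

lemma smooth_on_has_derivative:
  "smooth_on S f \<Longrightarrow> u \<in> S \<Longrightarrow> (f has_derivative frechet_derivative f (at u)) (at u)"
  unfolding smooth_on_def by (blast intro: Ck_on_Suc_has_derivative)

lemma smooth_on_frechet_derivative:
  "smooth_on S f \<Longrightarrow> smooth_on S (\<lambda>u. frechet_derivative f (at u) a)"
  unfolding smooth_on_def by (metis Ck_on.simps(2))

lemma smooth_on_imp_continuous_on: "smooth_on S f \<Longrightarrow> continuous_on S f"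
  unfolding smooth_on_def by (metis Ck_on.simps(1))

text \<open>By Cramer's rule the solution of a regular linear system is a quotient of polynomials in
  the coefficients and the right-hand side.\<close>

lemma Ck_on_linear_system_solution:
  fixes M :: "'a::euclidean_space \<Rightarrow> real ^ 'n ^ 'n" and b x :: "'a \<Rightarrow> real ^ 'n"
  assumes S: "open S" and M: "\<And>i j. Ck_on k S (\<lambda>u. M u $ i $ j)" and b: "\<And>i. Ck_on k S (\<lambda>u. b u $ i)"
    and det: "\<And>u. u \<in> S \<Longrightarrow> det (M u) \<noteq> 0" and sol: "\<And>u. u \<in> S \<Longrightarrow> M u *v x u = b u"
  shows "Ck_on k S x"
  unfolding Ck_on_vec_iff[OF S]
proof
  fix i
  define N where "N u = (\<chi> r c. if c = i then b u $ r else M u $ r $ c)" for u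
  have det_Ck: "Ck_on k S (\<lambda>u. det (P u))" if "\<And>i j. Ck_on k S (\<lambda>u. P u $ i $ j)" for P :: "'a \<Rightarrow> real ^ 'n ^ 'n"
    unfolding det_def using that by (intro Ck_on_sum Ck_on_mult Ck_on_prod Ck_on_const S) auto
  have "Ck_on k S (\<lambda>u. det (N u) / det (M u))"
  proof (intro Ck_on_divide S det_Ck M det)
    show "Ck_on k S (\<lambda>u. N u $ r $ c)" for r c
      using M b by (cases "c = i") (simp_all add: N_def)
  qed
  moreover have "x u $ i = det (N u) / det (M u)" if "u \<in> S" for u
    using cramer[OF det[OF that], of "x u" "b u"] sol[OF that] by (simp add: N_def)
  ultimately show "Ck_on k S (\<lambda>u. x u $ i)"
    using Ck_on_cong[OF S, of k "\<lambda>u. det (N u) / det (M u)" "\<lambda>u. x u $ i"] by simp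
qed

text \<open>The mean value theorem is applied twice, first in direction \<open>a\<close> to the increment of \<open>f\<close> in
  direction \<open>b\<close>, then in direction \<open>b\<close>. The left-hand side is symmetric in \<open>a\<close> and \<open>b\<close>, which is what
  forces mixed derivatives to agree.\<close>

lemma second_difference_mean_value:
  fixes f :: "'a::euclidean_space \<Rightarrow> real"
  assumes df: "\<And>y. y \<in> ball x r \<Longrightarrow> f differentiable (at y)"
    and ddf: "\<And>y. y \<in> ball x r \<Longrightarrow> (\<lambda>u. frechet_derivative f (at u) a) differentiable (at y)"
    and h: "0 < h" "h * (norm a + norm b) < r"
  obtains y where "dist x y \<le> h * (norm a + norm b)"
    "f (x + h *\<^sub>R a + h *\<^sub>R b) - f (x + h *\<^sub>R a) - f (x + h *\<^sub>R b) + f x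
      = h * h * frechet_derivative (\<lambda>u. frechet_derivative f (at u) a) (at y) b"
proof -
  have ball: "x + s *\<^sub>R a + t *\<^sub>R b \<in> ball x r" "dist x (x + s *\<^sub>R a + t *\<^sub>R b) \<le> h * (norm a + norm b)"
    if "0 \<le> s" "s \<le> h" "0 \<le> t" "t \<le> h" for s t
  proof -
    have "norm (s *\<^sub>R a + t *\<^sub>R b) \<le> s * norm a + t * norm b"
      using that norm_triangle_ineq[of "s *\<^sub>R a" "t *\<^sub>R b"] by simp
    also have "\<dots> \<le> h * (norm a + norm b)"
      using that by (simp add: distrib_left add_mono mult_right_mono)
    finally have "norm (s *\<^sub>R a + t *\<^sub>R b) \<le> h * (norm a + norm b)" .
    moreover have "dist x (x + s *\<^sub>R a + t *\<^sub>R b) = norm (s *\<^sub>R a + t *\<^sub>R b)"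
      by (simp add: dist_norm norm_minus_commute add.assoc add.commute)
    ultimately show "x + s *\<^sub>R a + t *\<^sub>R b \<in> ball x r" "dist x (x + s *\<^sub>R a + t *\<^sub>R b) \<le> h * (norm a + norm b)"
      using h by auto
  qed
  define Df where "Df u = frechet_derivative f (at u) a" for u
  have line: "((\<lambda>s. f (x + s *\<^sub>R a + t *\<^sub>R b)) has_real_derivative Df (x + s *\<^sub>R a + t *\<^sub>R b)) (at s)"
    if st: "0 \<le> s" "s \<le> h" "0 \<le> t" "t \<le> h" for s t
  proof -
    have D: "(f has_derivative frechet_derivative f (at (x + s *\<^sub>R a + t *\<^sub>R b))) (at (x + s *\<^sub>R a + t *\<^sub>R b))"
      using df[OF ball(1)[OF st]] frechet_derivative_works by blast
    have "((\<lambda>s. x + s *\<^sub>R a + t *\<^sub>R b) has_derivative (\<lambda>h. h *\<^sub>R a)) (at s)"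
      by (auto intro!: derivative_eq_intros)
    from has_derivative_compose[OF this D] show ?thesis
      using linear_cmul[OF has_derivative_linear[OF D]] unfolding has_field_derivative_def Df_def
      by (simp add: mult_commute_abs)
  qed
  have "\<exists>\<xi>. 0 < \<xi> \<and> \<xi> < h \<and> (f (x + h *\<^sub>R a + h *\<^sub>R b) - f (x + h *\<^sub>R a + 0 *\<^sub>R b))
      - (f (x + 0 *\<^sub>R a + h *\<^sub>R b) - f (x + 0 *\<^sub>R a + 0 *\<^sub>R b))
      = (h - 0) * (Df (x + \<xi> *\<^sub>R a + h *\<^sub>R b) - Df (x + \<xi> *\<^sub>R a + 0 *\<^sub>R b))"
    by (rule MVT2[where f = "\<lambda>s. f (x + s *\<^sub>R a + h *\<^sub>R b) - f (x + s *\<^sub>R a + 0 *\<^sub>R b)"])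
      (use h(1) in \<open>auto intro!: DERIV_diff line simp del: scaleR_zero_left\<close>)
  then obtain \<xi> where \<xi>: "0 < \<xi>" "\<xi> < h" "f (x + h *\<^sub>R a + h *\<^sub>R b) - f (x + h *\<^sub>R a) - f (x + h *\<^sub>R b) + f x
      = h * (Df (x + \<xi> *\<^sub>R a + h *\<^sub>R b) - Df (x + \<xi> *\<^sub>R a))"
    by (auto simp: algebra_simps)
  have line2: "((\<lambda>t. Df (x + \<xi> *\<^sub>R a + t *\<^sub>R b)) has_real_derivative
      frechet_derivative Df (at (x + \<xi> *\<^sub>R a + t *\<^sub>R b)) b) (at t)"
    if t: "0 \<le> t" "t \<le> h" for t
  proof -
    have D: "(Df has_derivative frechet_derivative Df (at (x + \<xi> *\<^sub>R a + t *\<^sub>R b))) (at (x + \<xi> *\<^sub>R a + t *\<^sub>R b))"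
      using ddf[OF ball(1)[of \<xi> t]] t \<xi> frechet_derivative_works unfolding Df_def by fastforce
    have "((\<lambda>t. x + \<xi> *\<^sub>R a + t *\<^sub>R b) has_derivative (\<lambda>h. h *\<^sub>R b)) (at t)"
      by (auto intro!: derivative_eq_intros)
    from has_derivative_compose[OF this D] show ?thesis
      using linear_cmul[OF has_derivative_linear[OF D]] unfolding has_field_derivative_def
      by (simp add: mult_commute_abs)
  qed
  have "\<exists>\<eta>. 0 < \<eta> \<and> \<eta> < h \<and> Df (x + \<xi> *\<^sub>R a + h *\<^sub>R b) - Df (x + \<xi> *\<^sub>R a + 0 *\<^sub>R b)
      = (h - 0) * frechet_derivative Df (at (x + \<xi> *\<^sub>R a + \<eta> *\<^sub>R b)) b"
    by (rule MVT2[where f = "\<lambda>t. Df (x + \<xi> *\<^sub>R a + t *\<^sub>R b)"]) (use h(1) in \<open>auto intro!: line2\<close>)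
  then obtain \<eta> where \<eta>: "0 < \<eta>" "\<eta> < h" "Df (x + \<xi> *\<^sub>R a + h *\<^sub>R b) - Df (x + \<xi> *\<^sub>R a)
      = h * frechet_derivative Df (at (x + \<xi> *\<^sub>R a + \<eta> *\<^sub>R b)) b"
    by auto
  show thesis
    by (rule that[OF ball(2)[of \<xi> \<eta>]]) (use \<xi> \<eta> in \<open>auto simp: Df_def[abs_def]\<close>)
qed

text \<open>Both iterated derivatives occur as values of the same second difference quotient at points
  arbitrarily close to \<open>x\<close>, so they agree at \<open>x\<close> by continuity.\<close>

lemma symmetric_second_derivative:
  fixes f :: "'a::euclidean_space \<Rightarrow> real"
  assumes S: "open S" "x \<in> S" and f: "smooth_on S f"
  shows "frechet_derivative (\<lambda>u. frechet_derivative f (at u) a) (at x) b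
    = frechet_derivative (\<lambda>u. frechet_derivative f (at u) b) (at x) a"
proof -
  define P where "P a b u = frechet_derivative (\<lambda>u. frechet_derivative f (at u) a) (at u) b" for a b u
  have diff: "f differentiable (at y)" "(\<lambda>u. frechet_derivative f (at u) c) differentiable (at y)"
    if "y \<in> S" for y c
    using smooth_on_has_derivative[OF f that] smooth_on_has_derivative[OF smooth_on_frechet_derivative[OF f] that]
    unfolding differentiable_def by blast+
  have cont: "isCont (P c d) x" for c d
    using smooth_on_imp_continuous_on[OF smooth_on_frechet_derivative[OF smooth_on_frechet_derivative[OF f]]] S
    unfolding P_def[abs_def] by (simp add: continuous_on_eq_continuous_at)
  have "\<bar>P a b x - P b a x\<bar> \<le> e" if "e > 0" for e
  proof -
    obtain r where r: "r > 0" "ball x r \<subseteq> S" using S by (auto simp: open_contains_ball)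
    obtain d1 where d1: "d1 > 0" "\<And>y. dist y x < d1 \<Longrightarrow> dist (P a b y) (P a b x) < e / 2"
      using cont[of a b] \<open>e > 0\<close> unfolding continuous_at_eps_delta by (meson half_gt_zero)
    obtain d2 where d2: "d2 > 0" "\<And>y. dist y x < d2 \<Longrightarrow> dist (P b a y) (P b a x) < e / 2"
      using cont[of b a] \<open>e > 0\<close> unfolding continuous_at_eps_delta by (meson half_gt_zero)
    define m where "m = min r (min d1 d2)"
    \<comment> \<open>the summand \<open>1\<close> keeps the denominator positive when \<open>a = b = 0\<close>\<close>
    define h where "h = m / (norm a + norm b + 1)"
    have pos: "norm a + norm b + 1 > 0" by (simp add: add_nonneg_pos)
    have m: "m > 0" using r d1 d2 by (simp add: m_def)
    have h: "h > 0" "h * (norm a + norm b) < m"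
      using m pos by (simp_all add: h_def field_simps)
    obtain y1 where y1: "dist x y1 \<le> h * (norm a + norm b)"
      "f (x + h *\<^sub>R a + h *\<^sub>R b) - f (x + h *\<^sub>R a) - f (x + h *\<^sub>R b) + f x = h * h * P a b y1"
      by (rule second_difference_mean_value[of x m f a h b])
        (use diff r h in \<open>auto simp: m_def P_def\<close>)
    obtain y2 where y2: "dist x y2 \<le> h * (norm b + norm a)"
      "f (x + h *\<^sub>R b + h *\<^sub>R a) - f (x + h *\<^sub>R b) - f (x + h *\<^sub>R a) + f x = h * h * P b a y2"
      by (rule second_difference_mean_value[of x m f b h a])
        (use diff r h in \<open>auto simp: m_def P_def add.commute\<close>)
    have "h * h * P a b y1 = h * h * P b a y2"
      using y1(2) y2(2) by (simp add: algebra_simps)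
    then have "P a b y1 = P b a y2" using h by simp
    moreover have "dist y1 x < d1" "dist y2 x < d2"
      using y1(1) y2(1) h by (auto simp: m_def dist_commute add.commute)
    ultimately show ?thesis using d1(2)[of y1] d2(2)[of y2] unfolding dist_real_def by linarith
  qed
  then have "\<bar>P a b x - P b a x\<bar> \<le> 0" by (rule field_le_epsilon) simp
  then show ?thesis unfolding P_def by simp
qed

text \<open>The derivative of the local inverse \<open>\<psi>\<close> solves the linear system with matrix
  \<open>D f (\<psi> y)\<close>, so each degree of smoothness of \<open>\<psi>\<close> yields the next one.\<close>

lemma smooth_local_inverse:
  fixes f :: "real ^ 'n::finite \<Rightarrow> real ^ 'n"
  assumes U: "open U" "x \<in> U" and f: "smooth_on U f"
    and inj: "\<And>v. frechet_derivative f (at x) v = 0 \<Longrightarrow> v = 0"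
  obtains U' V \<psi> where "open U'" "U' \<subseteq> U" "x \<in> U'" "open V" "homeomorphism U' V f \<psi>" "smooth_on V \<psi>"
proof -
  define f' where "f' u = Blinfun (frechet_derivative f (at u))" for u
  have f': "blinfun_apply (f' u) = frechet_derivative f (at u)" if "u \<in> U" for u
    unfolding f'_def using smooth_on_has_derivative[OF f that] has_derivative_bounded_linear
    by (intro bounded_linear_Blinfun_apply)
  have derf: "(f has_derivative blinfun_apply (f' u)) (at u)" if "u \<in> U" for u
    using f' smooth_on_has_derivative[OF f] that by metis
  have contf: "continuous_on U f'"
  proof (rule continuous_on_blinfun_componentwise)
    fix i :: "real ^ 'n"
    show "continuous_on U (\<lambda>u. blinfun_apply (f' u) i)"
      using smooth_on_imp_continuous_on[OF smooth_on_frechet_derivative[OF f]] f'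
      by (simp cong: continuous_on_cong)
  qed
  have lin: "linear (blinfun_apply (f' u))" for u
    by (rule bounded_linear.linear[OF blinfun.bounded_linear_right])
  have "inj (blinfun_apply (f' x))"
    using lin[of x] inj f'[OF U(2)] linear_injective_0 by metis
  then obtain l where l: "linear l" "l \<circ> blinfun_apply (f' x) = id"
    using linear_injective_left_inverse[OF lin] by blast
  have invf: "Blinfun l o\<^sub>L f' x = id_blinfun"
  proof (rule blinfun_eqI)
    fix v
    have "blinfun_apply (Blinfun l) = l"
      using l(1) by (intro bounded_linear_Blinfun_apply) (simp add: linear_conv_bounded_linear)
    then show "blinfun_apply (Blinfun l o\<^sub>L f' x) v = blinfun_apply id_blinfun v"
      using fun_cong[OF l(2), of v] by simp
  qed
  obtain U' V \<psi> \<psi>' where *: "open U'" "U' \<subseteq> U" "x \<in> U'" "open V" "f x \<in> V" "homeomorphism U' V f \<psi>"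
    and der: "\<And>y. y \<in> V \<Longrightarrow> (\<psi> has_derivative (\<psi>' y)) (at y)"
    and \<psi>': "\<And>y. y \<in> V \<Longrightarrow> \<psi>' y = inv (blinfun_apply (f'(\<psi> y)))"
    and bij: "\<And>y. y \<in> V \<Longrightarrow> bij (blinfun_apply (f'(\<psi> y)))"
    using inverse_function_theorem[OF U(1) derf contf U(2) invf] by metis
  have \<psi>_in: "\<psi> y \<in> U" if "y \<in> V" for y
    using *(2,6) that unfolding homeomorphism_def by blast
  define M where "M y = matrix (blinfun_apply (f' (\<psi> y)))" for y
  have M: "M y *v v = blinfun_apply (f' (\<psi> y)) v" for y v
    unfolding M_def using lin by (simp add: matrix_works)
  have "Ck_on k V \<psi>" for k
  proof (induction k)
    case 0
    then show ?case using *(6) by (simp add: homeomorphism_def)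
  next
    case (Suc k)
    show ?case
    proof (rule Ck_on_SucI[OF *(4) der])
      fix a
      show "Ck_on k V (\<lambda>y. \<psi>' y a)"
      proof (rule Ck_on_linear_system_solution[OF *(4)])
        show "Ck_on k V (\<lambda>y. M y $ i $ j)" for i j
        proof -
          have "Ck_on k U (\<lambda>u. frechet_derivative f (at u) (axis j 1))"
            using smooth_on_frechet_derivative[OF f] unfolding smooth_on_def by blast
          then have "Ck_on k V (\<lambda>y. frechet_derivative f (at (\<psi> y)) (axis j 1))"
            using \<psi>_in Ck_on_compose[OF *(4) U(1) Suc] by blast
          then have "Ck_on k V (\<lambda>y. frechet_derivative f (at (\<psi> y)) (axis j 1) $ i)"
            by (rule Ck_on_linear_compose[OF *(4) bounded_linear_vec_nth])
          then show ?thesis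
            by (rule Ck_on_cong[OF *(4)]) (simp add: M_def matrix_def f' \<psi>_in)
        qed
        show "Ck_on k V (\<lambda>y. a $ i)" for i using *(4) by (rule Ck_on_const)
        show "det (M y) \<noteq> 0" if "y \<in> V" for y
          using bij[OF that] lin M_def det_nz_iff_inj bij_is_inj by metis
        show "M y *v \<psi>' y a = a" if "y \<in> V" for y
          using bij[OF that] \<psi>'[OF that] by (simp add: M bij_is_surj surj_f_inv_f)
      qed
    qed
  qed
  then have "smooth_on V \<psi>" by (simp add: smooth_on_def)
  then show thesis using that * by blast
qed


section \<open>Charts\<close>

lemma
  assumes "is_chart T c"
  shows chart_open_iff: "U \<subseteq> dom_of c \<Longrightarrow> open (coord c ` U) \<longleftrightarrow> openin T U"
    and coord_inv_coord: "p \<in> dom_of c \<Longrightarrow> coord_inv c (coord c p) = p"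
    and coord_coord_inv: "u \<in> coord c ` dom_of c \<Longrightarrow> coord c (coord_inv c u) = u"
    and coord_inv_in: "u \<in> coord c ` dom_of c \<Longrightarrow> coord_inv c u \<in> dom_of c"
proof -
  note chart = assms[unfolded is_chart_def]
  have top: "topspace (subtopology T (dom_of c)) = dom_of c"
    using chart openin_subset by auto
  have inj: "inj_on (coord c) (dom_of c)"
    using chart homeomorphic_imp_injective_map top by metis
  show "open (coord c ` U) \<longleftrightarrow> openin T U" if "U \<subseteq> dom_of c"
  proof -
    have "openin (top_of_set (coord c ` dom_of c)) (coord c ` U) \<longleftrightarrow> openin (subtopology T (dom_of c)) U"
      using chart that top by (intro homeomorphic_map_openness) auto
    then show ?thesis
      using chart that by (auto simp: openin_open_eq openin_open_subtopology image_mono)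
  qed
  show "coord_inv c (coord c p) = p" if "p \<in> dom_of c"
    using inj that by (simp add: coord_inv_def)
  show "coord c (coord_inv c u) = u" "coord_inv c u \<in> dom_of c" if "u \<in> coord c ` dom_of c"
    using that by (simp_all add: coord_inv_def f_inv_into_f inv_into_into)
qed

locale manifold =
  fixes T :: "'a topology" and A :: "('a, 'n::finite) chart set"
  assumes manifold: "smooth_manifold T A"
begin

lemma is_chart: "c \<in> A \<Longrightarrow> is_chart T c"
  using manifold unfolding smooth_manifold_def by blast

lemma openin_dom: "c \<in> A \<Longrightarrow> openin T (dom_of c)"
  using is_chart by (auto simp: is_chart_def)

lemma dom_subset: "c \<in> A \<Longrightarrow> dom_of c \<subseteq> topspace T"
  using openin_dom openin_subset by blast

lemma open_img: "c \<in> A \<Longrightarrow> openin T W \<Longrightarrow> open (coord c ` (dom_of c \<inter> W))"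
  using chart_open_iff[OF is_chart, of c "dom_of c \<inter> W"] openin_dom by blast

lemma open_img_dom: "c \<in> A \<Longrightarrow> open (coord c ` dom_of c)"
  using is_chart by (auto simp: is_chart_def)

lemma chart_at:
  assumes "p \<in> topspace T"
  shows "chart_at A p \<in> A" "p \<in> dom_of (chart_at A p)"
proof -
  have "\<exists>c. c \<in> A \<and> p \<in> dom_of c" using manifold assms unfolding smooth_manifold_def by blast
  from someI_ex[OF this] show "chart_at A p \<in> A" "p \<in> dom_of (chart_at A p)"
    unfolding chart_at_def by auto
qed

lemma smooth_transition:
  "c \<in> A \<Longrightarrow> d \<in> A \<Longrightarrow> smooth_on (coord c ` (dom_of c \<inter> dom_of d)) (transition c d)"
  using manifold unfolding smooth_manifold_def compatible_def by blast

lemma transition_coord: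
  "c \<in> A \<Longrightarrow> p \<in> dom_of c \<Longrightarrow> transition c d (coord c p) = coord d p"
  by (simp add: transition_def coord_inv_coord[OF is_chart])

lemma transition_has_derivative:
  assumes "c \<in> A" "d \<in> A" "p \<in> dom_of c" "p \<in> dom_of d"
  shows "(transition c d has_derivative frechet_derivative (transition c d) (at (coord c p))) (at (coord c p))"
  using assms by (intro smooth_on_has_derivative[OF smooth_transition]) auto

text \<open>Near a point, the coordinate expressions of a map in two charts differ by the transition map.\<close>

lemma coord_change_has_derivative:
  fixes f :: "'a \<Rightarrow> 'b::real_normed_vector"
  assumes "c \<in> A" "d \<in> A" "p \<in> dom_of c" "p \<in> dom_of d"
    and f: "((f \<circ> coord_inv d) has_derivative f') (at (coord d p))"
  shows "((f \<circ> coord_inv c) has_derivative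
    (\<lambda>v. f' (frechet_derivative (transition c d) (at (coord c p)) v))) (at (coord c p))"
proof -
  have "((f \<circ> coord_inv d) has_derivative f') (at (transition c d (coord c p)))"
    using f assms by (simp add: transition_coord)
  from has_derivative_compose[OF transition_has_derivative[OF assms(1-4)] this]
  have "((\<lambda>u. (f \<circ> coord_inv d) (transition c d u)) has_derivative
    (\<lambda>v. f' (frechet_derivative (transition c d) (at (coord c p)) v))) (at (coord c p))" .
  then show ?thesis
  proof (rule has_derivative_transform_within_open)
    show "open (coord c ` (dom_of c \<inter> dom_of d))" using assms openin_dom open_img by blast
    show "coord c p \<in> coord c ` (dom_of c \<inter> dom_of d)" using assms by auto
    show "(f \<circ> coord_inv d) (transition c d u) = (f \<circ> coord_inv c) u"
      if "u \<in> coord c ` (dom_of c \<inter> dom_of d)" for u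
      using that assms by (auto simp: transition_def coord_inv_coord[OF is_chart])
  qed
qed

lemma transition_cocycle:
  assumes "c \<in> A" "d \<in> A" "e \<in> A" "p \<in> dom_of c" "p \<in> dom_of d" "p \<in> dom_of e"
  shows "frechet_derivative (transition c e) (at (coord c p)) v =
    frechet_derivative (transition d e) (at (coord d p)) (frechet_derivative (transition c d) (at (coord c p)) v)"
  using frechet_derivative_at[OF coord_change_has_derivative[OF assms(1,2,4,5),
      OF transition_has_derivative[OF assms(2,3,5,6), unfolded transition_def]]]
  by (simp add: transition_def fun_eq_iff)

lemma transition_self:
  assumes "c \<in> A" "p \<in> dom_of c"
  shows "frechet_derivative (transition c c) (at (coord c p)) v = v"
proof -
  have "frechet_derivative (transition c c) (at (coord c p)) = frechet_derivative id (at (coord c p))"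
    by (rule frechet_derivative_cong_open[OF open_img_dom[OF assms(1)]])
      (use assms in \<open>auto simp: transition_def coord_inv_coord[OF is_chart]\<close>)
  then show ?thesis by simp
qed

text \<open>A local diffeomorphism of Euclidean space composed with a chart is a chart, because the
  atlas is maximal.\<close>

lemma chart_reparametrize:
  assumes c: "c \<in> A" and U: "open U" "U \<subseteq> coord c ` dom_of c" and V: "open V"
    and hom: "homeomorphism U V f h" and f: "smooth_on U f" and h: "smooth_on V h"
  shows "(coord_inv c ` U, f \<circ> coord c) \<in> A"
proof -
  define e where "e = (coord_inv c ` U, f \<circ> coord c)"
  note ic = is_chart[OF c]
  have sub: "dom_of e \<subseteq> dom_of c" using U coord_inv_in[OF ic] by (auto simp: e_def)
  have img_c: "coord c ` dom_of e = U" using U coord_coord_inv[OF ic] by (force simp: e_def)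
  have fU: "f ` U = V" and hV: "h ` V = U" and hf: "\<And>u. u \<in> U \<Longrightarrow> h (f u) = u" and fh: "\<And>y. y \<in> V \<Longrightarrow> f (h y) = y"
    using hom by (auto simp: homeomorphism_def)
  have img_e: "coord e ` dom_of e = V" using img_c fU by (simp add: e_def flip: image_image)
  have "openin T (dom_of e)" using chart_open_iff[OF ic sub] img_c U(1) by simp
  moreover have "homeomorphic_map (subtopology T (dom_of e)) (top_of_set V) (coord e)"
  proof -
    have "homeomorphic_map (subtopology (subtopology T (dom_of c)) (dom_of e))
        (subtopology (top_of_set (coord c ` dom_of c)) U) (coord c)"
    proof (rule homeomorphic_map_subtopologies)
      show "homeomorphic_map (subtopology T (dom_of c)) (top_of_set (coord c ` dom_of c)) (coord c)"
        using ic by (simp add: is_chart_def)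
      have "topspace (subtopology T (dom_of c)) \<inter> dom_of e = dom_of e"
        using sub dom_subset[OF c] by auto
      then show "coord c ` (topspace (subtopology T (dom_of c)) \<inter> dom_of e)
          = topspace (top_of_set (coord c ` dom_of c)) \<inter> U"
        using img_c U(2) by (simp add: Int_absorb1)
    qed
    then have "homeomorphic_map (subtopology T (dom_of e)) (top_of_set U) (coord c)"
      using sub U by (simp add: subtopology_subtopology Int_absorb1)
    moreover have "homeomorphic_map (top_of_set U) (top_of_set V) f"
      using hom unfolding homeomorphic_map_maps homeomorphic_maps_def homeomorphism_def by force
    ultimately show ?thesis unfolding e_def by (simp add: homeomorphic_map_compose)
  qed
  ultimately have ie: "is_chart T e" using img_e V by (simp add: is_chart_def)
  have inv_e: "coord_inv e y = coord_inv c (h y)" if y: "y \<in> V" for y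
  proof -
    have "coord_inv c (h y) \<in> dom_of e" using y hV by (auto simp: e_def)
    moreover have "h y \<in> coord c ` dom_of c" using y hV U(2) by blast
    then have "coord e (coord_inv c (h y)) = y"
      using coord_coord_inv[OF ic] fh[OF y] by (simp add: e_def)
    ultimately show ?thesis using coord_inv_coord[OF ie] by metis
  qed
  have "compatible e d" if d: "d \<in> A" for d
    unfolding compatible_def
  proof
    have open_e: "open (coord e ` (dom_of e \<inter> dom_of d))" "open (coord d ` (dom_of e \<inter> dom_of d))"
      "open (coord c ` (dom_of c \<inter> dom_of d))"
      using chart_open_iff[OF ie, of "dom_of e \<inter> dom_of d"] chart_open_iff[OF is_chart[OF d], of "dom_of e \<inter> dom_of d"]
        openin_dom[OF d] \<open>openin T (dom_of e)\<close> open_img[OF c openin_dom[OF d]] by auto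
    have "smooth_on (coord e ` (dom_of e \<inter> dom_of d)) (\<lambda>y. transition c d (h y))"
    proof (rule smooth_on_compose[OF open_e(1,3) _ _ smooth_transition[OF c d]])
      show "smooth_on (coord e ` (dom_of e \<inter> dom_of d)) h"
        using img_e by (intro smooth_on_subset[OF h]) auto
      have "h (coord e p) = coord c p" if "p \<in> dom_of e" for p
        using that hf img_c by (auto simp: e_def)
      then show "h ` coord e ` (dom_of e \<inter> dom_of d) \<subseteq> coord c ` (dom_of c \<inter> dom_of d)"
        using sub by force
    qed
    then show "smooth_on (coord e ` (dom_of e \<inter> dom_of d)) (transition e d)"
      by (rule smooth_on_cong[OF open_e(1)]) (use img_e inv_e in \<open>auto simp: transition_def\<close>)
    have "smooth_on (coord d ` (dom_of e \<inter> dom_of d)) (\<lambda>y. f (transition d c y))"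
    proof (rule smooth_on_compose[OF open_e(2) U(1) _ _ f])
      show "smooth_on (coord d ` (dom_of e \<inter> dom_of d)) (transition d c)"
        using sub by (intro smooth_on_subset[OF smooth_transition[OF d c]]) auto
      show "transition d c ` coord d ` (dom_of e \<inter> dom_of d) \<subseteq> U"
        using img_c d by (auto simp: transition_coord)
    qed
    then show "smooth_on (coord d ` (dom_of e \<inter> dom_of d)) (transition d e)"
      by (rule smooth_on_cong[OF open_e(2)]) (simp add: transition_def e_def)
  qed
  then have "e \<in> A" using manifold ie unfolding smooth_manifold_def by blast
  then show ?thesis by (simp add: e_def)
qed


section \<open>Tangent vectors in coordinates\<close>

text \<open>The tangent vector at \<open>p\<close> whose components with respect to the chart \<open>c\<close> are \<open>x\<close>; this is the inverse
  of the isomorphism \<open>v \<mapsto> v c\<close> from the tangent space onto \<^typ>\<open>real ^ 'n\<close>.\<close>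

definition tangent_of :: "('a, 'n) chart \<Rightarrow> 'a \<Rightarrow> real ^ 'n \<Rightarrow> ('a, 'n) tvec" where
  "tangent_of c p x = (\<lambda>d.
     if d \<in> A \<and> p \<in> dom_of d then frechet_derivative (transition c d) (at (coord c p)) x else 0)"

lemma
  assumes c: "c \<in> A" "p \<in> dom_of c"
  shows tangent_of_in: "tangent_of c p x \<in> tangent_space A p"
    and tangent_of_comp: "tangent_of c p x c = x"
    and tangent_of_comp_inverse: "v \<in> tangent_space A p \<Longrightarrow> tangent_of c p (v c) = v"
    and tangent_of_linear: "tangent_of c p (a *\<^sub>R x + b *\<^sub>R y)
      = (\<lambda>d. a *\<^sub>R tangent_of c p x d + b *\<^sub>R tangent_of c p y d)"
    and tangent_of_axis: "tangent_of c p (axis i 1) = coord_vec A c i p"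
proof -
  show "tangent_of c p x \<in> tangent_space A p"
    unfolding tangent_space_def
  proof (intro CollectI conjI ballI allI impI)
    fix d e assume "d \<in> A" "e \<in> A" "p \<in> dom_of d \<and> p \<in> dom_of e"
    then show "tangent_of c p x e = frechet_derivative (transition d e) (at (coord d p)) (tangent_of c p x d)"
      using transition_cocycle[of c d e p x] c by (simp add: tangent_of_def)
  qed (auto simp: tangent_of_def)
  show "tangent_of c p x c = x"
    using c transition_self by (simp add: tangent_of_def)
  show "tangent_of c p (v c) = v" if "v \<in> tangent_space A p"
  proof
    fix d
    have "v d = frechet_derivative (transition c d) (at (coord c p)) (v c)" if "d \<in> A \<and> p \<in> dom_of d"
      using \<open>v \<in> tangent_space A p\<close> c that unfolding tangent_space_def by blast
    moreover have "v d = 0" if "\<not> (d \<in> A \<and> p \<in> dom_of d)"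
      using \<open>v \<in> tangent_space A p\<close> that unfolding tangent_space_def by blast
    ultimately show "tangent_of c p (v c) d = v d"
      unfolding tangent_of_def by presburger
  qed
  have "linear (frechet_derivative (transition c d) (at (coord c p)))" if "d \<in> A" "p \<in> dom_of d" for d
    using transition_has_derivative c that has_derivative_linear by blast
  then show "tangent_of c p (a *\<^sub>R x + b *\<^sub>R y)
      = (\<lambda>d. a *\<^sub>R tangent_of c p x d + b *\<^sub>R tangent_of c p y d)"
    by (auto simp: tangent_of_def linear_add linear_cmul)
  show "tangent_of c p (axis i 1) = coord_vec A c i p"
    by (simp add: tangent_of_def coord_vec_def)
qed

lemma tangent_eqI:
  assumes "c \<in> A" "p \<in> dom_of c" "v \<in> tangent_space A p" "w \<in> tangent_space A p" "v c = w c"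
  shows "v = w"
proof -
  have "v = tangent_of c p (w c)"
    using tangent_of_comp_inverse[OF assms(1-3)] unfolding assms(5) by (rule sym)
  also have "\<dots> = w" by (rule tangent_of_comp_inverse[OF assms(1,2,4)])
  finally show ?thesis .
qed

lemma smooth_fun_has_derivative:
  assumes "smooth_fun_on A (topspace T) f" "c \<in> A" "p \<in> dom_of c"
  shows "((f \<circ> coord_inv c) has_derivative frechet_derivative (f \<circ> coord_inv c) (at (coord c p))) (at (coord c p))"
proof (rule smooth_on_has_derivative)
  show "smooth_on (coord c ` dom_of c) (f \<circ> coord_inv c)"
    using bspec[OF assms(1)[unfolded smooth_fun_on_def] assms(2)]
    unfolding Int_absorb2[OF dom_subset[OF assms(2)]] .
  show "coord c p \<in> coord c ` dom_of c" using assms by simp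
qed

lemma differential_eq:
  assumes f: "smooth_fun_on A (topspace T) f" and c: "c \<in> A" "p \<in> dom_of c" and v: "v \<in> tangent_space A p"
  shows "differential A f p v = frechet_derivative (f \<circ> coord_inv c) (at (coord c p)) (v c)"
proof -
  define d where "d = chart_at A p"
  have d: "d \<in> A" "p \<in> dom_of d" using chart_at c dom_subset unfolding d_def by blast+
  have "v d = frechet_derivative (transition c d) (at (coord c p)) (v c)"
    using v c d unfolding tangent_space_def by blast
  then show ?thesis
    using fun_cong[OF frechet_derivative_at[OF coord_change_has_derivative[OF c(1) d(1) c(2) d(2)
          smooth_fun_has_derivative[OF f d]]], of "v c"]
    unfolding differential_def Let_def d_def by simp
qed

end


section \<open>Riemannian metrics in coordinates\<close>

lemma vec_eq_sum_axis:
  fixes x :: "real ^ 'n::finite"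
  shows "x = (\<Sum>i\<in>UNIV. (x $ i) *\<^sub>R axis i 1)"
  by (rule basis_expansion[of x, unfolded scalar_mult_eq_scaleR, symmetric])

lemma linear_eq_sum_axis:
  fixes f :: "real ^ 'n::finite \<Rightarrow> real"
  assumes "linear f"
  shows "f x = (\<Sum>i\<in>UNIV. x $ i * f (axis i 1))"
proof -
  have "f x = f (\<Sum>i\<in>UNIV. (x $ i) *\<^sub>R axis i 1)" by (rule arg_cong[OF vec_eq_sum_axis])
  then show ?thesis by (simp only: linear_sum[OF assms] linear_cmul[OF assms] real_scaleR_def)
qed

lemma frechet_derivative_eq_sum_pderiv:
  assumes "(f has_derivative frechet_derivative f (at u)) (at u)"
  shows "frechet_derivative f (at u) x = (\<Sum>i\<in>UNIV. x $ i * pderiv_at i f u)"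
  unfolding pderiv_at_def by (rule linear_eq_sum_axis[OF has_derivative_linear[OF assms]])

locale riemannian = manifold T A
  for T :: "'a topology" and A :: "('a, 'n::finite) chart set" +
  fixes g :: "('a, 'n) metric"
  assumes metric: "riemannian_metric T A g"
begin

lemma
  assumes "p \<in> topspace T" "v \<in> tangent_space A p" "w \<in> tangent_space A p"
  shows metric_sym: "g p v w = g p w v"
    and metric_pos: "v \<noteq> (\<lambda>c. 0) \<Longrightarrow> g p v v > 0"
    and metric_linear: "v' \<in> tangent_space A p \<Longrightarrow> g p (\<lambda>c. a *\<^sub>R v c + b *\<^sub>R v' c) w = a * g p v w + b * g p v' w"
proof -
  note m = bspec[OF conjunct1[OF metric[unfolded riemannian_metric_def]] assms(1)]
  show "g p v w = g p w v"
    by (rule bspec[OF bspec[OF conjunct1[OF m] assms(2)] assms(3)])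
  show "v \<noteq> (\<lambda>c. 0) \<Longrightarrow> g p v v > 0"
    by (rule mp[OF bspec[OF conjunct2[OF conjunct2[OF m]] assms(2)]])
  show "g p (\<lambda>c. a *\<^sub>R v c + b *\<^sub>R v' c) w = a * g p v w + b * g p v' w" if "v' \<in> tangent_space A p"
    by (rule bspec[OF bspec[OF bspec[OF conjunct1[OF conjunct2[OF m]] assms(2)] that] assms(3), THEN spec, THEN spec])
qed

lemma smooth_metric_comp: "c \<in> A \<Longrightarrow> smooth_on (coord c ` dom_of c) (metric_comp A g c i j)"
  by (rule bspec[OF conjunct2[OF metric[unfolded riemannian_metric_def]], THEN spec, THEN spec])

definition gram :: "('a, 'n) chart \<Rightarrow> real ^ 'n \<Rightarrow> real ^ 'n ^ 'n" where
  "gram c u = (\<chi> i j. metric_comp A g c i j u)"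

context
  fixes c p assumes c: "c \<in> A" "p \<in> dom_of c"
begin

lemma p_in: "p \<in> topspace T"
  using c dom_subset by blast

lemma metric_tangent_of:
  "g p (tangent_of c p x) (tangent_of c p y) = (\<Sum>i\<in>UNIV. \<Sum>j\<in>UNIV. x $ i * y $ j * metric_comp A g c i j (coord c p))"
proof -
  note T = tangent_of_in[OF c]
  define B where "B x y = g p (tangent_of c p x) (tangent_of c p y)" for x y
  have comb: "B (a *\<^sub>R x + b *\<^sub>R x') y = a * B x y + b * B x' y" for a b x x' y
    unfolding B_def tangent_of_linear[OF c] by (rule metric_linear[OF p_in T T T])
  have lin: "linear (\<lambda>x. B x y)" for y
  proof
    show "B (x + x') y = B x y + B x' y" for x x' using comb[of 1 x 1 x' y] by simp
    show "B (a *\<^sub>R x) y = a *\<^sub>R B x y" for a x using comb[of a x 0 x y] by simp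
  qed
  have sym: "B x y = B y x" for x y
    unfolding B_def by (rule metric_sym[OF p_in T T])
  have lin': "linear (B x)" for x
    using lin[of x] unfolding sym[of _ x] by simp
  have "B x y = (\<Sum>i\<in>UNIV. x $ i * B (axis i 1) y)"
    by (rule linear_eq_sum_axis[OF lin])
  also have "\<dots> = (\<Sum>i\<in>UNIV. x $ i * (\<Sum>j\<in>UNIV. y $ j * B (axis i 1) (axis j 1)))"
    by (intro sum.cong refl arg_cong[where f = "(*) _"] linear_eq_sum_axis[OF lin'])
  also have "\<dots> = (\<Sum>i\<in>UNIV. \<Sum>j\<in>UNIV. x $ i * y $ j * B (axis i 1) (axis j 1))"
    by (simp add: sum_distrib_left mult.assoc)
  finally have "B x y = (\<Sum>i\<in>UNIV. \<Sum>j\<in>UNIV. x $ i * y $ j * B (axis i 1) (axis j 1))" .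
  moreover have "B (axis i 1) (axis j 1) = metric_comp A g c i j (coord c p)" for i j
    unfolding B_def metric_comp_def tangent_of_axis[OF c] coord_inv_coord[OF is_chart[OF c(1)] c(2)] ..
  ultimately show ?thesis by (simp only: B_def)
qed

lemma metric_eq_inner_gram:
  assumes "v \<in> tangent_space A p" "w \<in> tangent_space A p"
  shows "g p v w = v c \<bullet> (gram c (coord c p) *v w c)"
proof -
  have "g p v w = g p (tangent_of c p (v c)) (tangent_of c p (w c))"
    unfolding tangent_of_comp_inverse[OF c assms(1)] tangent_of_comp_inverse[OF c assms(2)] ..
  then show ?thesis
    unfolding metric_tangent_of
    by (simp add: gram_def inner_vec_def matrix_vector_mult_def sum_distrib_left mult_ac)
qed

lemma metric_comp_sym: "metric_comp A g c i j (coord c p) = metric_comp A g c j i (coord c p)"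
  unfolding metric_comp_def coord_inv_coord[OF is_chart[OF c(1)] c(2)] tangent_of_axis[OF c, symmetric]
  by (rule metric_sym[OF p_in tangent_of_in[OF c] tangent_of_in[OF c]])

lemma gram_pos: "x \<noteq> 0 \<Longrightarrow> x \<bullet> (gram c (coord c p) *v x) > 0"
proof -
  assume "x \<noteq> 0"
  note comp = tangent_of_comp[OF c, of x]
  then have "tangent_of c p x \<noteq> (\<lambda>c. 0)" using \<open>x \<noteq> 0\<close> by metis
  then have "g p (tangent_of c p x) (tangent_of c p x) > 0"
    by (rule metric_pos[OF p_in tangent_of_in[OF c] tangent_of_in[OF c]])
  then show ?thesis
    unfolding metric_eq_inner_gram[OF tangent_of_in[OF c] tangent_of_in[OF c]] comp .
qed

lemma gram_eq_0_iff: "gram c (coord c p) *v x = 0 \<longleftrightarrow> x = 0"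
  using gram_pos[of x] by (cases "x = 0") auto

lemma gram_invertible: "invertible (gram c (coord c p))"
  unfolding invertible_left_inverse matrix_left_invertible_ker by (simp add: gram_eq_0_iff)

text \<open>In a chart the defining equation of the gradient is the linear system \<open>G x = dF\<close> with the Gram matrix
  \<open>G\<close> of the metric. Since \<open>G\<close> is positive definite, this gives existence, uniqueness and smoothness of
  gradients.\<close>

lemma gradient_char:
  assumes f: "smooth_fun_on A (topspace T) f" and v: "v \<in> tangent_space A p"
  shows "(\<forall>w\<in>tangent_space A p. g p v w = differential A f p w) \<longleftrightarrow>
    gram c (coord c p) *v v c = (\<chi> i. pderiv_at i (f \<circ> coord_inv c) (coord c p))"
    (is "?L \<longleftrightarrow> ?G = ?d")
proof -
  have gv: "g p v w = w c \<bullet> ?G" if "w \<in> tangent_space A p" for w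
    by (rule trans[OF metric_sym[OF p_in v that] metric_eq_inner_gram[OF that v]])
  have df: "differential A f p w = w c \<bullet> ?d" if "w \<in> tangent_space A p" for w
    unfolding differential_eq[OF f c that] frechet_derivative_eq_sum_pderiv[OF smooth_fun_has_derivative[OF f c]]
    by (simp add: inner_vec_def)
  show ?thesis
  proof
    assume L: ?L
    have "x \<bullet> ?G = x \<bullet> ?d" for x
    proof -
      have "g p v (tangent_of c p x) = differential A f p (tangent_of c p x)"
        by (rule bspec[OF L tangent_of_in[OF c]])
      then show ?thesis
        unfolding gv[OF tangent_of_in[OF c]] df[OF tangent_of_in[OF c]] tangent_of_comp[OF c] .
    qed
    then have "\<forall>x. x \<bullet> ?G = x \<bullet> ?d" by (rule allI)
    then show "?G = ?d" by (rule vector_eq_ldot[THEN iffD1])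
  next
    assume "?G = ?d"
    then show ?L by (intro ballI) (simp only: gv df)
  qed
qed

end

lemma
  assumes f: "smooth_fun_on A (topspace T) f" and p: "p \<in> topspace T"
  shows gradient_in: "gradient A g f p \<in> tangent_space A p"
    and metric_gradient: "w \<in> tangent_space A p \<Longrightarrow> g p (gradient A g f p) w = differential A f p w"
proof -
  define c where "c = chart_at A p"
  have c: "c \<in> A" "p \<in> dom_of c" using chart_at[OF p] by (simp_all add: c_def)
  let ?P = "\<lambda>v. v \<in> tangent_space A p \<and> (\<forall>w\<in>tangent_space A p. g p v w = differential A f p w)"
  let ?d = "\<chi> i. pderiv_at i (f \<circ> coord_inv c) (coord c p)"
  note inv = gram_invertible[OF c]
  have ex: "\<exists>x. gram c (coord c p) *v x = ?d"
    using inv by (metis invertible_def matrix_vector_mul_assoc matrix_vector_mul_lid)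
  then obtain x where x: "gram c (coord c p) *v x = ?d" by blast
  have "?P (tangent_of c p x)"
    using gradient_char[OF c f tangent_of_in[OF c]] tangent_of_in[OF c] x unfolding tangent_of_comp[OF c] by blast
  moreover have "v = v'" if "?P v" "?P v'" for v v'
  proof (rule tangent_eqI[OF c])
    have "gram c (coord c p) *v v c = gram c (coord c p) *v v' c"
      using gradient_char[OF c f, of v] gradient_char[OF c f, of v'] that by simp
    then have "gram c (coord c p) *v (v c - v' c) = 0" by (simp add: matrix_vector_mult_diff_distrib)
    then show "v c = v' c" using gram_eq_0_iff[OF c] by simp
  qed (use that in auto)
  ultimately have "?P (gradient A g f p)"
    unfolding gradient_def by (intro theI[where P = ?P]) blast+
  then show "gradient A g f p \<in> tangent_space A p"
    "w \<in> tangent_space A p \<Longrightarrow> g p (gradient A g f p) w = differential A f p w" by blast+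
qed

lemma gram_gradient:
  assumes "smooth_fun_on A (topspace T) f" "c \<in> A" "u \<in> coord c ` dom_of c"
  shows "gram c u *v gradient A g f (coord_inv c u) c = (\<chi> i. pderiv_at i (f \<circ> coord_inv c) u)"
proof -
  note cu = coord_inv_in[OF is_chart assms(3)] coord_coord_inv[OF is_chart assms(3)]
  have p: "coord_inv c u \<in> topspace T" using dom_subset cu assms by blast
  show ?thesis
    using gradient_char[OF assms(2) cu(1)] assms gradient_in[OF assms(1) p] metric_gradient[OF assms(1) p] cu(2)
    by metis
qed

lemma smooth_gradient_coord:
  assumes f: "smooth_fun_on A (topspace T) f" and c: "c \<in> A"
  shows "smooth_on (coord c ` dom_of c) (\<lambda>u. gradient A g f (coord_inv c u) c)"
  unfolding smooth_on_def
proof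
  fix k
  have sf: "smooth_on (coord c ` dom_of c) (f \<circ> coord_inv c)"
    using bspec[OF f[unfolded smooth_fun_on_def] c] unfolding Int_absorb2[OF dom_subset[OF c]] .
  show "Ck_on k (coord c ` dom_of c) (\<lambda>u. gradient A g f (coord_inv c u) c)"
  proof (rule Ck_on_linear_system_solution[OF open_img_dom[OF c]])
    show "Ck_on k (coord c ` dom_of c) (\<lambda>u. gram c u $ i $ j)" for i j
      using smooth_metric_comp[OF c] by (simp add: gram_def smooth_on_def)
    show "Ck_on k (coord c ` dom_of c) (\<lambda>u. (\<chi> i. pderiv_at i (f \<circ> coord_inv c) u) $ i)" for i
      using smooth_on_frechet_derivative[OF sf] by (simp add: pderiv_at_def smooth_on_def)
    show "det (gram c u) \<noteq> 0" if "u \<in> coord c ` dom_of c" for u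
      using gram_invertible[OF c] that invertible_det_nz by blast
  qed (rule gram_gradient[OF f c])
qed

end


section \<open>The Hessian in coordinates\<close>

text \<open>With \<open>dg i a b = \<partial>\<^sub>i g\<^sub>a\<^sub>b\<close>, the two sums are the Christoffel contributions to the Hessians of two
  functions with gradients \<open>X\<close> and \<open>Y\<close>. The terms \<open>dg j i l - dg l i j\<close> are antisymmetric in \<open>j\<close> and \<open>l\<close> and
  cancel after renaming indices in one of the sums.\<close>

lemma christoffel_terms_cancel:
  fixes dg :: "'n::finite \<Rightarrow> 'n \<Rightarrow> 'n \<Rightarrow> real" and X Y :: "real ^ 'n"
  assumes "\<And>i a b. dg i a b = dg i b a"
  shows "(\<Sum>j\<in>UNIV. (1/2 * (\<Sum>l\<in>UNIV. X $ l * (dg i j l + dg j i l - dg l i j))) * Y $ j)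
    + (\<Sum>j\<in>UNIV. (1/2 * (\<Sum>l\<in>UNIV. Y $ l * (dg i j l + dg j i l - dg l i j))) * X $ j)
    = (\<Sum>j\<in>UNIV. \<Sum>l\<in>UNIV. dg i j l * Y $ j * X $ l)" (is "?L + ?R = _")
proof -
  have R: "?R = (\<Sum>j\<in>UNIV. \<Sum>l\<in>UNIV. 1/2 * X $ l * Y $ j * (dg i l j + dg l i j - dg j i l))"
    by (subst sum.swap) (simp add: sum_distrib_left sum_distrib_right mult_ac)
  have L: "?L = (\<Sum>j\<in>UNIV. \<Sum>l\<in>UNIV. 1/2 * X $ l * Y $ j * (dg i j l + dg j i l - dg l i j))"
    by (simp add: sum_distrib_left sum_distrib_right mult_ac)
  have "1/2 * X $ l * Y $ j * (dg i j l + dg j i l - dg l i j) + 1/2 * X $ l * Y $ j * (dg i l j + dg l i j - dg j i l)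
      = dg i j l * Y $ j * X $ l" for j l
    unfolding assms[of i l j] by algebra
  then show ?thesis
    unfolding L R sum.distrib[symmetric] by simp
qed

lemma matrix_inv_right_inverse:
  fixes M :: "real ^ 'n::finite ^ 'n"
  assumes "invertible M"
  shows "M ** matrix_inv M = mat 1"
  using someI_ex[OF assms[unfolded invertible_def]] unfolding matrix_inv_def by simp

text \<open>Pairwise orthogonal non-isotropic vectors are linearly independent, and as many of them as the
  dimension form a basis; the coefficients are found by pairing with each of them.\<close>

lemma orthogonal_expansion:
  fixes M :: "real ^ 'n::finite ^ 'n" and x :: "'n \<Rightarrow> real ^ 'n"
  assumes orth: "\<And>i j. i \<noteq> j \<Longrightarrow> x i \<bullet> (M *v x j) = 0" and nz: "\<And>i. x i \<bullet> (M *v x i) \<noteq> 0"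
  shows "v = (\<Sum>k\<in>UNIV. ((v \<bullet> (M *v x k)) / (x k \<bullet> (M *v x k))) *\<^sub>R x k)"
proof -
  define L where "L a = (\<Sum>k\<in>UNIV. (a $ k) *\<^sub>R x k)" for a :: "real ^ 'n"
  have lin: "linear L"
    unfolding L_def by (intro linearI) (simp_all add: scaleR_add_left sum.distrib scaleR_right.sum)
  have comp: "L a \<bullet> (M *v x k) = a $ k * (x k \<bullet> (M *v x k))" for a k
  proof -
    have "L a \<bullet> (M *v x k) = (\<Sum>j\<in>UNIV. a $ j * (x j \<bullet> (M *v x k)))"
      by (simp add: L_def inner_sum_left)
    also have "\<dots> = (\<Sum>j\<in>UNIV. if j = k then a $ k * (x k \<bullet> (M *v x k)) else 0)"
      using orth by (intro sum.cong) auto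
    finally show ?thesis by simp
  qed
  have "inj L"
    unfolding linear_injective_0[OF lin]
  proof (intro allI impI)
    fix a assume "L a = 0"
    then have "a $ k * (x k \<bullet> (M *v x k)) = 0" for k
      using comp[of a k] by simp
    then show "a = 0" using nz by (simp add: vec_eq_iff)
  qed
  then have "surj L" by (rule linear_inj_imp_surj[OF lin])
  then obtain a where a: "v = L a" by (auto simp: surj_def)
  have coeff: "(v \<bullet> (M *v x k)) / (x k \<bullet> (M *v x k)) = a $ k" for k
    unfolding a comp using nz by simp
  show ?thesis unfolding coeff by (rule a[unfolded L_def])
qed

context riemannian
begin

lemma smooth_fun_coord:
  "smooth_fun_on A (topspace T) f \<Longrightarrow> c \<in> A \<Longrightarrow> smooth_on (coord c ` dom_of c) (f \<circ> coord_inv c)"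
  using bspec[of A _ c] dom_subset[of c] unfolding smooth_fun_on_def by (metis Int_absorb2)

lemma smooth_pderiv_at:
  "smooth_on S F \<Longrightarrow> smooth_on S (pderiv_at i F)"
  unfolding pderiv_at_def[abs_def] by (rule smooth_on_frechet_derivative)

text \<open>The expression that defines \<^const>\<open>hessian\<close>, but in a prescribed chart and as a form on component
  vectors.\<close>

definition coord_hessian :: "('a, 'n) chart \<Rightarrow> ('a \<Rightarrow> real) \<Rightarrow> real ^ 'n \<Rightarrow> real ^ 'n \<Rightarrow> real ^ 'n \<Rightarrow> real" where
  "coord_hessian c f u x y = (\<Sum>i\<in>UNIV. \<Sum>j\<in>UNIV.
     (pderiv_at i (pderiv_at j (f \<circ> coord_inv c)) u
       - (\<Sum>k\<in>UNIV. christoffel A g c k i j u * pderiv_at k (f \<circ> coord_inv c) u)) * x $ i * y $ j)"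

lemma hessian_eq_coord_hessian:
  "hessian A g f p v w = coord_hessian (chart_at A p) f (coord (chart_at A p) p) (v (chart_at A p)) (w (chart_at A p))"
  unfolding hessian_def coord_hessian_def Let_def ..

lemma coord_hessian_scaleR:
  "coord_hessian c f u (a *\<^sub>R x) (b *\<^sub>R y) = a * b * coord_hessian c f u x y"
  unfolding coord_hessian_def sum_distrib_left by (simp add: mult_ac)

lemma metric_comp_sym_on:
  assumes "c \<in> A" "u \<in> coord c ` dom_of c"
  shows "metric_comp A g c i j u = metric_comp A g c j i u"
  using metric_comp_sym[OF assms(1)] assms(2) by blast

lemma pderiv_at_metric_comp_sym:
  assumes "c \<in> A" "u \<in> coord c ` dom_of c"
  shows "pderiv_at l (metric_comp A g c i j) u = pderiv_at l (metric_comp A g c j i) u"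
proof -
  have "frechet_derivative (metric_comp A g c i j) (at u) = frechet_derivative (metric_comp A g c j i) (at u)"
    by (rule frechet_derivative_cong_open[OF open_img_dom[OF assms(1)] assms(2)])
      (rule metric_comp_sym_on[OF assms(1)])
  then show ?thesis by (simp add: pderiv_at_def)
qed

lemma coord_hessian_sym:
  assumes f: "smooth_fun_on A (topspace T) f" and c: "c \<in> A" "u \<in> coord c ` dom_of c"
  shows "coord_hessian c f u x y = coord_hessian c f u y x"
proof -
  have "pderiv_at i (pderiv_at j (f \<circ> coord_inv c)) u = pderiv_at j (pderiv_at i (f \<circ> coord_inv c)) u" for i j
    unfolding pderiv_at_def[abs_def]
    by (rule symmetric_second_derivative[OF open_img_dom[OF c(1)] c(2) smooth_fun_coord[OF f c(1)]])
  moreover have "christoffel A g c k i j u = christoffel A g c k j i u" for k i j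
    unfolding christoffel_def Let_def pderiv_at_metric_comp_sym[OF c, of _ i j] by (simp add: add.commute)
  ultimately show ?thesis
    unfolding coord_hessian_def by (subst sum.swap) (simp add: mult_ac)
qed

text \<open>Contracting with the covector \<open>G x\<close> removes the inverse Gram matrix from the Christoffel symbols.
  For a gradient \<open>x\<close> this covector is the differential that occurs in the Hessian.\<close>

lemma christoffel_contraction:
  assumes c: "c \<in> A" "u \<in> coord c ` dom_of c"
  shows "(\<Sum>k\<in>UNIV. christoffel A g c k i j u * (gram c u *v x) $ k)
    = 1/2 * (\<Sum>l\<in>UNIV. x $ l * (pderiv_at i (metric_comp A g c j l) u
        + pderiv_at j (metric_comp A g c i l) u - pderiv_at l (metric_comp A g c i j) u))"
proof -
  define I where "I = matrix_inv (gram c u)"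
  define t where "t l = pderiv_at i (metric_comp A g c j l) u
        + pderiv_at j (metric_comp A g c i l) u - pderiv_at l (metric_comp A g c i j) u" for l
  have inv: "invertible (gram c u)" using gram_invertible[OF c(1)] c(2) by blast
  have "transpose (gram c u) = gram c u"
    using metric_comp_sym_on[OF c] by (simp add: transpose_def gram_def vec_eq_iff)
  then have "transpose I ** gram c u = transpose (gram c u ** I)"
    by (simp add: matrix_transpose_mul)
  then have "transpose I ** gram c u = mat 1"
    using matrix_inv_right_inverse[OF inv] by (simp add: I_def transpose_mat)
  then have "transpose I *v (gram c u *v x) = x"
    by (simp add: matrix_vector_mul_assoc)
  moreover have "(transpose I *v z) $ l = (\<Sum>k\<in>UNIV. I $ k $ l * z $ k)" for z l
    by (simp add: matrix_vector_mult_def transpose_def)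
  ultimately have x: "x $ l = (\<Sum>k\<in>UNIV. I $ k $ l * (gram c u *v x) $ k)" for l
    by (rule subst)
  have "christoffel A g c k i j u = 1/2 * (\<Sum>l\<in>UNIV. I $ k $ l * t l)" for k
    unfolding christoffel_def Let_def I_def t_def gram_def ..
  then have "(\<Sum>k\<in>UNIV. christoffel A g c k i j u * (gram c u *v x) $ k)
      = (\<Sum>k\<in>UNIV. \<Sum>l\<in>UNIV. 1/2 * (I $ k $ l * (gram c u *v x) $ k) * t l)"
    by (simp add: sum_distrib_left sum_distrib_right mult_ac)
  also have "\<dots> = (\<Sum>l\<in>UNIV. \<Sum>k\<in>UNIV. 1/2 * (I $ k $ l * (gram c u *v x) $ k) * t l)"
    by (rule sum.swap)
  also have "\<dots> = (\<Sum>l\<in>UNIV. 1/2 * (\<Sum>k\<in>UNIV. I $ k $ l * (gram c u *v x) $ k) * t l)"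
    unfolding sum_distrib_left sum_distrib_right ..
  also have "\<dots> = (\<Sum>l\<in>UNIV. 1/2 * x $ l * t l)" unfolding x[symmetric] ..
  finally show ?thesis unfolding t_def by (simp add: sum_distrib_left mult.assoc)
qed

lemma coord_hessian_add:
  assumes f: "smooth_fun_on A (topspace T) f" and h: "smooth_fun_on A (topspace T) h"
    and c: "c \<in> A" "u \<in> coord c ` dom_of c"
  defines "X \<equiv> gradient A g f (coord_inv c u) c" and "Y \<equiv> gradient A g h (coord_inv c u) c"
  shows "coord_hessian c f u w Y + coord_hessian c h u w X =
    (\<Sum>i\<in>UNIV. w $ i * ((\<Sum>j\<in>UNIV. pderiv_at i (pderiv_at j (f \<circ> coord_inv c)) u * Y $ j)
      + (\<Sum>j\<in>UNIV. pderiv_at i (pderiv_at j (h \<circ> coord_inv c)) u * X $ j)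
      - (\<Sum>j\<in>UNIV. \<Sum>l\<in>UNIV. pderiv_at i (metric_comp A g c j l) u * Y $ j * X $ l)))"
proof -
  define dg where "dg i j l = pderiv_at i (metric_comp A g c j l) u" for i j l
  have contr: "(\<Sum>k\<in>UNIV. christoffel A g c k i j u * pderiv_at k (F \<circ> coord_inv c) u)
      = 1/2 * (\<Sum>l\<in>UNIV. gradient A g F (coord_inv c u) c $ l * (dg i j l + dg j i l - dg l i j))"
    if "smooth_fun_on A (topspace T) F" for F i j
    using christoffel_contraction[OF c, of i j "gradient A g F (coord_inv c u) c"]
    unfolding gram_gradient[OF that c] dg_def by simp
  have sym: "dg i a b = dg i b a" for i a b
    unfolding dg_def by (rule pderiv_at_metric_comp_sym[OF c])
  have H: "coord_hessian c F u w Z = (\<Sum>i\<in>UNIV. w $ i * ((\<Sum>j\<in>UNIV. pderiv_at i (pderiv_at j (F \<circ> coord_inv c)) u * Z $ j)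
      - (\<Sum>j\<in>UNIV. (1/2 * (\<Sum>l\<in>UNIV. gradient A g F (coord_inv c u) c $ l * (dg i j l + dg j i l - dg l i j))) * Z $ j)))"
    if "smooth_fun_on A (topspace T) F" for F Z
    unfolding coord_hessian_def contr[OF that] sum_subtractf[symmetric] sum_distrib_left
    by (intro sum.cong refl) algebra
  show ?thesis
    unfolding H[OF f] H[OF h] dg_def[symmetric] christoffel_terms_cancel[of dg, OF sym, symmetric]
      X_def[symmetric] Y_def[symmetric]
    by (rule trans[OF sum.distrib[symmetric]]) (intro sum.cong refl, algebra)
qed

text \<open>One of the two gradients is replaced by the differential of its function, so that
  only the components of a single gradient have to be differentiated.\<close>

lemma metric_gradients_coord:
  assumes f: "smooth_fun_on A (topspace T) f" and h: "smooth_fun_on A (topspace T) h"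
    and c: "c \<in> A" "u \<in> coord c ` dom_of c"
  shows "g (coord_inv c u) (gradient A g f (coord_inv c u)) (gradient A g h (coord_inv c u))
    = (\<Sum>a\<in>UNIV. gradient A g f (coord_inv c u) c $ a * pderiv_at a (h \<circ> coord_inv c) u)"
proof -
  have p: "coord_inv c u \<in> dom_of c" "coord c (coord_inv c u) = u"
    using coord_inv_in coord_coord_inv is_chart c by blast+
  have pT: "coord_inv c u \<in> topspace T" using p dom_subset c by blast
  show ?thesis
    unfolding metric_eq_inner_gram[OF c(1) p(1) gradient_in[OF f pT] gradient_in[OF h pT]] p(2)
      gram_gradient[OF h c] by (simp add: inner_vec_def)
qed

lemma smooth_metric_gradients:
  assumes f: "smooth_fun_on A (topspace T) f" and h: "smooth_fun_on A (topspace T) h" and c: "c \<in> A"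
  shows "smooth_on (coord c ` dom_of c) ((\<lambda>q. g q (gradient A g f q) (gradient A g h q)) \<circ> coord_inv c)"
proof (rule smooth_on_cong[OF open_img_dom[OF c]])
  show "smooth_on (coord c ` dom_of c)
      (\<lambda>u. \<Sum>a\<in>UNIV. gradient A g f (coord_inv c u) c $ a * pderiv_at a (h \<circ> coord_inv c) u)"
    using smooth_gradient_coord[OF f c] smooth_pderiv_at[OF smooth_fun_coord[OF h c]]
    unfolding smooth_on_vec_iff[OF open_img_dom[OF c]] unfolding smooth_on_def
    by (intro allI Ck_on_sum Ck_on_mult open_img_dom c) blast+
qed (simp add: metric_gradients_coord[OF f h c])

text \<open>The product rule \<open>w \<langle>\<nabla>f, \<nabla>h\<rangle> = Hess f (w, \<nabla>h) + Hess h (w, \<nabla>f)\<close>, which expresses that the Levi-Civita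
  connection is metric. The derivative of the components \<open>x\<close> of \<open>\<nabla>f\<close> is not computed; it only enters
  through \<open>G dx\<close>, which is known from differentiating the system solved by \<open>x\<close>.\<close>

lemma metric_gradients_has_derivative:
  assumes f: "smooth_fun_on A (topspace T) f" and h: "smooth_fun_on A (topspace T) h"
    and c: "c \<in> A" "u \<in> coord c ` dom_of c"
  defines "X \<equiv> gradient A g f (coord_inv c u) c" and "Y \<equiv> gradient A g h (coord_inv c u) c"
  shows "(((\<lambda>q. g q (gradient A g f q) (gradient A g h q)) \<circ> coord_inv c) has_derivative
    (\<lambda>w. coord_hessian c f u w Y + coord_hessian c h u w X)) (at u)"
proof -
  define S where "S = coord c ` dom_of c"
  have S: "open S" "u \<in> S" using open_img_dom c by (simp_all add: S_def)
  define x where "x a v = gradient A g f (coord_inv c v) c $ a" for a v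
  define F where "F = f \<circ> coord_inv c"
  define H where "H = h \<circ> coord_inv c"
  define m where "m = metric_comp A g c"
  have smooth: "smooth_on S (x a)" "smooth_on S (pderiv_at a F)" "smooth_on S (pderiv_at a H)" "smooth_on S (m a b)"
    for a b
    using smooth_gradient_coord[OF f c(1)] smooth_pderiv_at smooth_fun_coord[OF f c(1)] smooth_fun_coord[OF h c(1)]
      smooth_metric_comp[OF c(1)]
    unfolding smooth_on_vec_iff[OF S(1)[unfolded S_def]] unfolding S_def x_def[abs_def] F_def H_def m_def by blast+
  have der: "(q has_derivative frechet_derivative q (at u)) (at u)"
    "frechet_derivative q (at u) w = (\<Sum>i\<in>UNIV. w $ i * pderiv_at i q u)" if "smooth_on S q" for q w
    using smooth_on_has_derivative[OF that S(2)] frechet_derivative_eq_sum_pderiv by blast+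
  have sol: "(\<Sum>b\<in>UNIV. m a b v * x b v) = pderiv_at a F v" if "v \<in> S" for a v
    using gram_gradient[OF f c(1), of v] that
    by (simp add: S_def vec_eq_iff matrix_vector_mult_def gram_def x_def F_def m_def)
  have solY: "(\<Sum>b\<in>UNIV. m a b u * Y $ b) = pderiv_at a H u" for a
    using gram_gradient[OF h c] by (simp add: vec_eq_iff matrix_vector_mult_def gram_def Y_def H_def m_def)
  define dx where "dx a = frechet_derivative (x a) (at u)" for a
  define dm where "dm a b = frechet_derivative (m a b) (at u)" for a b
  define dF where "dF a = frechet_derivative (pderiv_at a F) (at u)" for a
  define dH where "dH a = frechet_derivative (pderiv_at a H) (at u)" for a
  have X: "x a u = X $ a" for a by (simp add: x_def X_def)
  have lin: "(\<Sum>b\<in>UNIV. m a b u * dx b w + dm a b w * X $ b) = dF a w" for a w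
  proof -
    have "((\<lambda>v. \<Sum>b\<in>UNIV. m a b v * x b v) has_derivative
        (\<lambda>w. \<Sum>b\<in>UNIV. m a b u * dx b w + dm a b w * x b u)) (at u)"
      unfolding dx_def dm_def by (intro has_derivative_sum has_derivative_mult der smooth)
    then have "(pderiv_at a F has_derivative
        (\<lambda>w. \<Sum>b\<in>UNIV. m a b u * dx b w + dm a b w * x b u)) (at u)"
      by (rule has_derivative_transform_within_open[OF _ S]) (rule sol)
    from fun_cong[OF frechet_derivative_at[OF this]] show ?thesis
      unfolding dF_def X .
  qed
  have "((\<lambda>v. \<Sum>a\<in>UNIV. x a v * pderiv_at a H v) has_derivative
      (\<lambda>w. \<Sum>a\<in>UNIV. x a u * dH a w + dx a w * pderiv_at a H u)) (at u)"
    unfolding dx_def dH_def by (intro has_derivative_sum has_derivative_mult der smooth)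
  then have "(((\<lambda>q. g q (gradient A g f q) (gradient A g h q)) \<circ> coord_inv c) has_derivative
      (\<lambda>w. \<Sum>a\<in>UNIV. x a u * dH a w + dx a w * pderiv_at a H u)) (at u)"
    by (rule has_derivative_transform_within_open[OF _ S])
      (simp add: metric_gradients_coord[OF f h c(1)] S_def x_def H_def)
  moreover have "(\<Sum>a\<in>UNIV. x a u * dH a w + dx a w * pderiv_at a H u)
      = coord_hessian c f u w Y + coord_hessian c h u w X" for w
  proof -
    have msym: "m a b u = m b a u" for a b
      unfolding m_def by (rule metric_comp_sym_on[OF c])
    \<comment> \<open>substitute \<open>\<partial>\<^sub>a H = (G Y)\<^sub>a\<close> and move the symmetric matrix \<open>G\<close> to \<open>dx\<close>\<close>
    have "(\<Sum>a\<in>UNIV. dx a w * pderiv_at a H u) = (\<Sum>a\<in>UNIV. \<Sum>b\<in>UNIV. dx a w * (m a b u * Y $ b))"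
      unfolding solY[symmetric] sum_distrib_left ..
    also have "\<dots> = (\<Sum>b\<in>UNIV. \<Sum>a\<in>UNIV. dx a w * (m a b u * Y $ b))"
      by (rule sum.swap)
    also have "\<dots> = (\<Sum>b\<in>UNIV. Y $ b * (\<Sum>a\<in>UNIV. m b a u * dx a w))"
      unfolding sum_distrib_left
    proof (intro sum.cong refl)
      show "dx a w * (m a b u * Y $ b) = Y $ b * (m b a u * dx a w)" for a b
        unfolding msym[of a b] by simp
    qed
    also have "\<dots> = (\<Sum>b\<in>UNIV. Y $ b * (dF b w - (\<Sum>l\<in>UNIV. dm b l w * X $ l)))"
      unfolding lin[symmetric] by (simp add: sum.distrib)
    finally have 1: "(\<Sum>a\<in>UNIV. dx a w * pderiv_at a H u)
      = (\<Sum>b\<in>UNIV. Y $ b * dF b w) - (\<Sum>b\<in>UNIV. \<Sum>l\<in>UNIV. dm b l w * Y $ b * X $ l)"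
      by (simp add: right_diff_distrib sum_subtractf sum_distrib_left mult_ac)
    have 2: "(\<Sum>b\<in>UNIV. Z $ b * frechet_derivative (q b) (at u) w)
        = (\<Sum>i\<in>UNIV. w $ i * (\<Sum>j\<in>UNIV. pderiv_at i (q j) u * Z $ j))"
      if "\<And>b. smooth_on S (q b)" for q Z
      unfolding der(2)[OF that] sum_distrib_left by (subst sum.swap) (simp add: mult_ac)
    have "(\<Sum>b\<in>UNIV. \<Sum>l\<in>UNIV. dm b l w * Y $ b * X $ l)
      = (\<Sum>b\<in>UNIV. \<Sum>l\<in>UNIV. \<Sum>i\<in>UNIV. w $ i * (pderiv_at i (m b l) u * Y $ b * X $ l))"
      unfolding dm_def der(2)[OF smooth(4)] sum_distrib_right mult.assoc ..
    also have "\<dots> = (\<Sum>b\<in>UNIV. \<Sum>i\<in>UNIV. \<Sum>l\<in>UNIV. w $ i * (pderiv_at i (m b l) u * Y $ b * X $ l))"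
      by (intro sum.cong refl sum.swap)
    also have "\<dots> = (\<Sum>i\<in>UNIV. \<Sum>b\<in>UNIV. \<Sum>l\<in>UNIV. w $ i * (pderiv_at i (m b l) u * Y $ b * X $ l))"
      by (rule sum.swap)
    also have "\<dots> = (\<Sum>i\<in>UNIV. w $ i * (\<Sum>b\<in>UNIV. \<Sum>l\<in>UNIV. pderiv_at i (m b l) u * Y $ b * X $ l))"
      unfolding sum_distrib_left ..
    finally have 3: "(\<Sum>b\<in>UNIV. \<Sum>l\<in>UNIV. dm b l w * Y $ b * X $ l) = \<dots>" .
    have "(\<Sum>a\<in>UNIV. x a u * dH a w + dx a w * pderiv_at a H u)
      = (\<Sum>i\<in>UNIV. w $ i * (\<Sum>j\<in>UNIV. pderiv_at i (pderiv_at j H) u * X $ j))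
      + (\<Sum>i\<in>UNIV. w $ i * (\<Sum>j\<in>UNIV. pderiv_at i (pderiv_at j F) u * Y $ j))
      - (\<Sum>i\<in>UNIV. w $ i * (\<Sum>b\<in>UNIV. \<Sum>l\<in>UNIV. pderiv_at i (m b l) u * Y $ b * X $ l))"
      unfolding sum.distrib 1 X 3 dF_def dH_def using 2[of "\<lambda>a. pderiv_at a H" X, OF smooth(3)]
        2[of "\<lambda>a. pderiv_at a F" Y, OF smooth(2)] by simp
    also have "\<dots> = coord_hessian c f u w Y + coord_hessian c h u w X"
      unfolding X_def Y_def coord_hessian_add[OF f h c] F_def H_def m_def
      by (simp add: sum.distrib sum_subtractf distrib_left right_diff_distrib)
    finally show ?thesis .
  qed
  ultimately show ?thesis by simp
qed

end


section \<open>Orthogonal limiting Carleman weights\<close>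

locale orthogonal_weights = riemannian T A g
  for T :: "'a topology" and A :: "('a, 'n::finite) chart set" and g :: "('a, 'n) metric" +
  fixes \<phi> :: "'n \<Rightarrow> 'a \<Rightarrow> real"
  assumes weights: "orthogonal_LCWs T A g \<phi>"
begin

abbreviation grad :: "'n \<Rightarrow> 'a \<Rightarrow> ('a, 'n) tvec" where
  "grad i \<equiv> gradient A g (\<phi> i)"

definition grad_sq :: "'n \<Rightarrow> 'a \<Rightarrow> real" where
  "grad_sq i p = g p (grad i p) (grad i p)"

lemma LCW: "limiting_carleman_weight T A g (\<phi> i)"
  using weights unfolding orthogonal_LCWs_def by blast

lemma smooth_weight: "smooth_fun_on A (topspace T) (\<phi> i)"
  using LCW unfolding limiting_carleman_weight_def by blast

lemma orthogonal: "i \<noteq> j \<Longrightarrow> p \<in> topspace T \<Longrightarrow> g p (grad i p) (grad j p) = 0"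
  using weights unfolding orthogonal_LCWs_def by blast

lemmas grad_in = gradient_in[OF smooth_weight]

lemma grad_sq_pos:
  assumes p: "p \<in> topspace T"
  shows "grad_sq i p > 0"
proof -
  obtain v where v: "v \<in> tangent_space A p" "differential A (\<phi> i) p v \<noteq> 0"
    using LCW[of i] p unfolding limiting_carleman_weight_def by blast
  have "g p (\<lambda>c. 0) v = 0"
    using metric_linear[OF p v(1) v(1) v(1), of 0 0] by simp
  then have "grad i p \<noteq> (\<lambda>c. 0)"
    using v metric_gradient[OF smooth_weight p v(1), of i] by auto
  then show ?thesis
    unfolding grad_sq_def by (rule metric_pos[OF p grad_in[OF p] grad_in[OF p]])
qed

lemma expansion:
  assumes c: "c \<in> A" "p \<in> dom_of c"
  shows "x = (\<Sum>k\<in>UNIV. ((x \<bullet> (gram c (coord c p) *v grad k p c)) / grad_sq k p) *\<^sub>R grad k p c)"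
proof -
  have p: "p \<in> topspace T" using p_in[OF c] .
  have g: "grad i p c \<bullet> (gram c (coord c p) *v grad j p c) = g p (grad i p) (grad j p)" for i j
    using metric_eq_inner_gram[OF c grad_in[OF p] grad_in[OF p]] by simp
  show ?thesis
    unfolding grad_sq_def g[symmetric]
  proof (rule orthogonal_expansion)
    show "grad i p c \<bullet> (gram c (coord c p) *v grad j p c) = 0" if "i \<noteq> j" for i j
      unfolding g by (rule orthogonal[OF that p])
    show "grad i p c \<bullet> (gram c (coord c p) *v grad i p c) \<noteq> 0" for i
      unfolding g using grad_sq_pos[OF p, of i] by (simp add: grad_sq_def)
  qed
qed

text \<open>The gradients form an orthogonal frame, hence \<open>g = \<Sum>\<^sub>k d\<phi>\<^sub>k\<^sup>2 / |\<nabla>\<phi>\<^sub>k|\<^sup>2\<close>.\<close>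

lemma metric_eq_sum_differentials:
  assumes p: "p \<in> topspace T" and v: "v \<in> tangent_space A p" and w: "w \<in> tangent_space A p"
  shows "g p v w = (\<Sum>k\<in>UNIV. differential A (\<phi> k) p v * differential A (\<phi> k) p w / grad_sq k p)"
proof -
  define c where "c = chart_at A p"
  have c: "c \<in> A" "p \<in> dom_of c" using chart_at[OF p] by (simp_all add: c_def)
  have comp: "z c \<bullet> (gram c (coord c p) *v grad k p c) = differential A (\<phi> k) p z" if "z \<in> tangent_space A p" for z k
    unfolding metric_eq_inner_gram[OF c that grad_in[OF p], symmetric] metric_sym[OF p that grad_in[OF p]]
    by (rule metric_gradient[OF smooth_weight p that])
  have "w c = (\<Sum>k\<in>UNIV. (differential A (\<phi> k) p w / grad_sq k p) *\<^sub>R grad k p c)"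
    using expansion[OF c, of "w c"] unfolding comp[OF w] .
  then have "g p v w = v c \<bullet> (gram c (coord c p) *v (\<Sum>k\<in>UNIV. (differential A (\<phi> k) p w / grad_sq k p) *\<^sub>R grad k p c))"
    unfolding metric_eq_inner_gram[OF c v w] by (rule arg_cong)
  also have "\<dots> = (\<Sum>k\<in>UNIV. (differential A (\<phi> k) p w / grad_sq k p) * (v c \<bullet> (gram c (coord c p) *v grad k p c)))"
    by (simp add: linear_sum[OF matrix_vector_mul_linear] linear_cmul[OF matrix_vector_mul_linear] inner_sum_right)
  finally show ?thesis unfolding comp[OF v] by (simp add: mult.commute)
qed

text \<open>Write \<open>N\<^sub>i = |\<nabla>\<phi>\<^sub>i|\<^sup>2\<close> and \<open>a\<^sub>i = Hess \<phi>\<^sub>i\<close>. By the product rule \<open>dN\<^sub>i(w) = 2 a\<^sub>i(w, \<nabla>\<phi>\<^sub>i)\<close>, and for \<open>i \<noteq> k\<close>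
  orthogonality and the symmetry of \<open>a\<^sub>i\<close> turn \<open>a\<^sub>i(\<nabla>\<phi>\<^sub>k, \<nabla>\<phi>\<^sub>i)\<close> into \<open>- a\<^sub>k(\<nabla>\<phi>\<^sub>i, \<nabla>\<phi>\<^sub>i)\<close>, which the Carleman condition for \<open>\<phi>\<^sub>k\<close>
  evaluates as \<open>a\<^sub>k(\<nabla>\<phi>\<^sub>k, \<nabla>\<phi>\<^sub>k) N\<^sub>i / N\<^sub>k\<close>. So \<open>dN\<^sub>i(\<nabla>\<phi>\<^sub>k) / N\<^sub>i\<close> is the same for all \<open>i\<close>. The chart is the one in
  which the Hessians at \<open>p\<close> are evaluated.\<close>

lemma grad_sq_ratio_stationary:
  assumes p: "p \<in> topspace T"
  defines "c \<equiv> chart_at A p"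
  shows "(((\<lambda>q. grad_sq i q / grad_sq j q) \<circ> coord_inv c) has_derivative (\<lambda>w. 0)) (at (coord c p))"
proof -
  have c: "c \<in> A" "p \<in> dom_of c" using chart_at[OF p] by (simp_all add: c_def)
  define u where "u = coord c p"
  have u: "u \<in> coord c ` dom_of c" "coord_inv c u = p"
    using c coord_inv_coord[OF is_chart[OF c(1)]] by (simp_all add: u_def)
  define a where "a i x y = coord_hessian c (\<phi> i) u x y" for i x y
  define X where "X i = grad i p c" for i
  have der: "(((\<lambda>q. g q (grad i q) (grad j q)) \<circ> coord_inv c) has_derivative
      (\<lambda>w. a i w (X j) + a j w (X i))) (at u)" for i j
    using metric_gradients_has_derivative[OF smooth_weight smooth_weight c(1) u(1)]
    unfolding u(2) a_def X_def .
  have sym: "a i x y = a i y x" for i x y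
    unfolding a_def by (rule coord_hessian_sym[OF smooth_weight c(1) u(1)])
  have orth: "a i w (X j) + a j w (X i) = 0" if "i \<noteq> j" for i j w
  proof -
    have "(((\<lambda>q. g q (grad i q) (grad j q)) \<circ> coord_inv c) has_derivative (\<lambda>w. 0)) (at u)"
    proof (rule has_derivative_transform_within_open[OF has_derivative_const open_img_dom[OF c(1)] u(1)])
      fix v assume "v \<in> coord c ` dom_of c"
      then have "coord_inv c v \<in> topspace T"
        using coord_inv_in[OF is_chart[OF c(1)]] dom_subset[OF c(1)] by blast
      then show "0 = ((\<lambda>q. g q (grad i q) (grad j q)) \<circ> coord_inv c) v"
        using orthogonal[OF that] by simp
    qed
    from fun_cong[OF has_derivative_unique[OF der this]] show ?thesis .
  qed
  have lcw: "a k (X k) (X k) + (grad_sq k p / grad_sq i p) * a k (X i) (X i) = 0" if "i \<noteq> k" for i k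
  proof -
    define s where "s = sqrt (grad_sq k p / grad_sq i p)"
    have s: "s * s = grad_sq k p / grad_sq i p"
      using grad_sq_pos[OF p, of k] grad_sq_pos[OF p, of i] by (simp add: s_def)
    \<comment> \<open>the multiple of \<open>\<nabla>\<phi>\<^sub>i\<close> with the length of \<open>\<nabla>\<phi>\<^sub>k\<close>, an admissible \<open>V\<close> in the Carleman condition\<close>
    define v where "v = (\<lambda>d. s *\<^sub>R grad i p d)"
    note gi = grad_in[OF p, of i]
    have v_lin: "v = (\<lambda>d. s *\<^sub>R grad i p d + 0 *\<^sub>R grad i p d)" by (simp add: v_def)
    have v: "v \<in> tangent_space A p"
    proof -
      have "v = tangent_of c p (s *\<^sub>R X i + 0 *\<^sub>R X i)"
        unfolding tangent_of_linear[OF c] X_def tangent_of_comp_inverse[OF c gi] v_def by simp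
      then show ?thesis by (simp only: tangent_of_in[OF c])
    qed
    have g_v: "g p v w = s * g p (grad i p) w" if "w \<in> tangent_space A p" for w
      unfolding v_lin metric_linear[OF p gi that gi] by simp
    have "g p v v = s * s * grad_sq i p"
      unfolding g_v[OF v] metric_sym[OF p gi v] g_v[OF gi] grad_sq_def by simp
    then have "tnorm g p v = tnorm g p (grad k p)"
      using s grad_sq_pos[OF p, of i] by (simp add: tnorm_def grad_sq_def[symmetric])
    moreover have "g p v (grad k p) = 0"
      unfolding g_v[OF grad_in[OF p]] orthogonal[OF that p] by simp
    ultimately have "hessian A g (\<phi> k) p (grad k p) (grad k p) + hessian A g (\<phi> k) p v v = 0"
      using LCW[of k] p v unfolding limiting_carleman_weight_def by blast
    then have "a k (X k) (X k) + a k (s *\<^sub>R X i) (s *\<^sub>R X i) = 0"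
      unfolding hessian_eq_coord_hessian c_def[symmetric] u_def[symmetric] a_def X_def v_def .
    then show ?thesis unfolding a_def coord_hessian_scaleR s .
  qed
  have key: "a i (X k) (X i) * grad_sq k p = a k (X k) (X k) * grad_sq i p" for i k
  proof (cases "i = k")
    case False
    have "a i (X k) (X i) = - a k (X i) (X i)"
      using orth[OF False, of "X i"] sym[of i "X k" "X i"] by linarith
    moreover have "a k (X i) (X i) * grad_sq k p = - (a k (X k) (X k) * grad_sq i p)"
      using lcw[OF False] grad_sq_pos[OF p, of i] by (simp add: field_simps)
    ultimately show ?thesis by simp
  qed simp
  have der_sq: "((grad_sq i \<circ> coord_inv c) has_derivative (\<lambda>w. 2 * a i w (X i))) (at u)" for i
    using der[of i i] unfolding grad_sq_def[abs_def] by (simp only: mult_2)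
  have lin: "linear (\<lambda>w. 2 * a i w (X i) * grad_sq j p - 2 * a j w (X j) * grad_sq i p)" for i j
    by (rule has_derivative_linear[OF has_derivative_diff[OF has_derivative_mult_left[OF der_sq]
          has_derivative_mult_left[OF der_sq]]])
  \<comment> \<open>by linearity it suffices to consider \<open>w = \<nabla>\<phi>\<^sub>k\<close>, as the gradients span the tangent space\<close>
  have proportional: "2 * a i w (X i) * grad_sq j p - 2 * a j w (X j) * grad_sq i p = 0" for i j w
  proof -
    have 0: "2 * a i (X k) (X i) * grad_sq j p - 2 * a j (X k) (X j) * grad_sq i p = 0" for k
    proof -
      have "(2 * a i (X k) (X i) * grad_sq j p - 2 * a j (X k) (X j) * grad_sq i p) * grad_sq k p = 0"
        using key[of i k] key[of j k] by algebra
      then show ?thesis using grad_sq_pos[OF p, of k] by simp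
    qed
    show ?thesis
      using arg_cong[OF expansion[OF c, of w], where f = "\<lambda>w. 2 * a i w (X i) * grad_sq j p - 2 * a j w (X j) * grad_sq i p"]
      unfolding linear_sum[OF lin] linear_cmul[OF lin] X_def[symmetric] 0 by simp
  qed
  have "((\<lambda>v. (grad_sq i \<circ> coord_inv c) v / (grad_sq j \<circ> coord_inv c) v) has_derivative
      (\<lambda>w. (2 * a i w (X i) * (grad_sq j \<circ> coord_inv c) u - (grad_sq i \<circ> coord_inv c) u * (2 * a j w (X j)))
        / ((grad_sq j \<circ> coord_inv c) u * (grad_sq j \<circ> coord_inv c) u))) (at u)"
    using grad_sq_pos[OF p, of j] u(2) by (intro has_derivative_divide' der_sq) auto
  moreover have "2 * a i w (X i) * (grad_sq j \<circ> coord_inv c) u - (grad_sq i \<circ> coord_inv c) u * (2 * a j w (X j)) = 0" for w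
    using proportional[of i w j] by (simp add: u(2) algebra_simps)
  ultimately show ?thesis unfolding u_def[symmetric] by (simp only: comp_def div_0)
qed

text \<open>Unlike the Hessian formulas, the vanishing of a differential passes from one chart to another by
  the chain rule alone. This makes it possible to fix one chart and let \<open>p\<close> vary in it.\<close>

lemma grad_sq_ratio_stationary_chart:
  assumes c: "c \<in> A" "p \<in> dom_of c"
  shows "(((\<lambda>q. grad_sq i q / grad_sq j q) \<circ> coord_inv c) has_derivative (\<lambda>w. 0)) (at (coord c p))"
  using coord_change_has_derivative[OF c(1) chart_at(1) c(2) chart_at(2) grad_sq_ratio_stationary]
    p_in[OF c] by blast

text \<open>In the chart \<open>e\<close> the function \<open>b f\<close> is the \<open>i\<close>-th coordinate projection, which is linear and hence its
  own derivative.\<close>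

lemma tangent_comp_coordinate:
  assumes f: "smooth_fun_on A (topspace T) f" and e: "e \<in> A" "q \<in> dom_of e" and v: "v \<in> tangent_space A q"
    and coord: "\<And>q'. q' \<in> dom_of e \<Longrightarrow> coord e q' $ i = b * f q'"
  shows "v e $ i = b * differential A f q v"
proof -
  have "((\<lambda>y. b * (f \<circ> coord_inv e) y) has_derivative
      (\<lambda>x. b * frechet_derivative (f \<circ> coord_inv e) (at (coord e q)) x)) (at (coord e q))"
    by (intro has_derivative_mult_right smooth_fun_has_derivative[OF f e])
  then have "((\<lambda>y. y $ i) has_derivative
      (\<lambda>x. b * frechet_derivative (f \<circ> coord_inv e) (at (coord e q)) x)) (at (coord e q))"
  proof (rule has_derivative_transform_within_open[OF _ open_img_dom[OF e(1)]])
    show "coord e q \<in> coord e ` dom_of e" using e by simp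
    show "b * (f \<circ> coord_inv e) y = y $ i" if "y \<in> coord e ` dom_of e" for y
      using that coord by (auto simp: coord_inv_coord[OF is_chart[OF e(1)]])
  qed
  moreover have "((\<lambda>y :: real ^ 'n. y $ i) has_derivative (\<lambda>x. x $ i)) (at (coord e q))"
    by (rule bounded_linear_imp_has_derivative[OF bounded_linear_vec_nth])
  ultimately show ?thesis
    unfolding differential_eq[OF f e v] using has_derivative_unique fun_cong by metis
qed

text \<open>Near \<open>p\<close> the quotients \<open>N\<^sub>m / N\<^sub>i\<close> are constants \<open>\<kappa>\<^sub>i\<close>, so \<open>N\<^sub>m g = \<Sum>\<^sub>i \<kappa>\<^sub>i d\<phi>\<^sub>i\<^sup>2\<close> is the Euclidean metric
  in the coordinates \<open>sqrt \<kappa>\<^sub>i \<phi>\<^sub>i\<close>.\<close>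

lemma conformally_flat_if_weights: "conformally_flat T A g"
  unfolding conformally_flat_def
proof
  fix p assume p: "p \<in> topspace T"
  obtain c where c: "c \<in> A" "p \<in> dom_of c" using chart_at[OF p] by blast
  note ic = is_chart[OF c(1)]
  define S where "S = coord c ` dom_of c"
  define u where "u = coord c p"
  have S: "open S" "u \<in> S" using open_img_dom[OF c(1)] c by (simp_all add: S_def u_def)
  obtain r where r: "r > 0" "ball u r \<subseteq> S" using S by (auto simp: open_contains_ball)
  \<comment> \<open>any index serves: changing \<open>m\<close> rescales the flat metric by a constant\<close>
  define m :: 'n where "m = undefined"
  have in_T: "coord_inv c y \<in> topspace T" if "y \<in> S" for y
    using coord_inv_in[OF ic] that dom_subset[OF c(1)] unfolding S_def by blast
  define \<kappa> where "\<kappa> i = grad_sq m p / grad_sq i p" for i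
  have \<kappa>: "grad_sq m (coord_inv c y) / grad_sq i (coord_inv c y) = \<kappa> i" if y: "y \<in> ball u r" for y i
  proof -
    have "(((\<lambda>q. grad_sq m q / grad_sq i q) \<circ> coord_inv c) has_derivative (\<lambda>w. 0)) (at y within ball u r)"
      if "y \<in> ball u r" for y
    proof (rule has_derivative_at_withinI)
      have y: "y \<in> coord c ` dom_of c" using that r unfolding S_def by blast
      show "(((\<lambda>q. grad_sq m q / grad_sq i q) \<circ> coord_inv c) has_derivative (\<lambda>w. 0)) (at y)"
        using grad_sq_ratio_stationary_chart[OF c(1) coord_inv_in[OF ic y], of m i]
        unfolding coord_coord_inv[OF ic y] .
    qed
    then obtain z where z: "\<forall>y\<in>ball u r. ((\<lambda>q. grad_sq m q / grad_sq i q) \<circ> coord_inv c) y = z"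
      using has_derivative_zero_constant[OF convex_ball] by blast
    have "coord_inv c u = p" unfolding u_def by (rule coord_inv_coord[OF ic c(2)])
    then show ?thesis using bspec[OF z y] bspec[OF z, of u] r(1) by (simp add: \<kappa>_def)
  qed
  define \<beta> where "\<beta> i = sqrt (\<kappa> i)" for i
  have \<kappa>_pos: "\<kappa> i > 0" for i
    using grad_sq_pos[OF p] by (simp add: \<kappa>_def)
  have \<beta>: "\<beta> i * \<beta> i = \<kappa> i" "\<beta> i \<noteq> 0" for i
    using \<kappa>_pos[of i] by (simp_all add: \<beta>_def)
  define \<Psi> where "\<Psi> y = (\<chi> i. \<beta> i * (\<phi> i \<circ> coord_inv c) y)" for y
  have "smooth_on S \<Psi>"
    unfolding smooth_on_vec_iff[OF S(1)] \<Psi>_def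
    using smooth_fun_coord[OF smooth_weight c(1)] unfolding smooth_on_def S_def[symmetric] comp_def
    by (auto intro!: Ck_on_cmult S(1))
  then have \<Psi>_smooth: "smooth_on (ball u r) \<Psi>" using r(2) by (rule smooth_on_subset)
  \<comment> \<open>all \<open>d\<phi>\<^sub>i\<close> vanish on a vector in the kernel, so its \<open>g\<close>-length is zero\<close>
  have inj: "x = 0" if x: "frechet_derivative \<Psi> (at u) x = 0" for x
  proof -
    have "differential A (\<phi> i) p (tangent_of c p x) = 0" for i
    proof -
      have "((\<lambda>y. \<Psi> y $ i) has_derivative (\<lambda>x. frechet_derivative \<Psi> (at u) x $ i)) (at u)"
        using smooth_on_has_derivative[OF \<Psi>_smooth] r(1)
        by (intro bounded_linear.has_derivative[OF bounded_linear_vec_nth]) auto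
      moreover have "((\<lambda>y. \<Psi> y $ i) has_derivative (\<lambda>x. \<beta> i * frechet_derivative (\<phi> i \<circ> coord_inv c) (at u) x)) (at u)"
        unfolding \<Psi>_def vec_lambda_beta u_def
        by (intro has_derivative_mult_right smooth_fun_has_derivative[OF smooth_weight c])
      ultimately have "frechet_derivative \<Psi> (at u) x $ i = \<beta> i * frechet_derivative (\<phi> i \<circ> coord_inv c) (at u) x"
        using has_derivative_unique fun_cong by metis
      then show ?thesis
        unfolding differential_eq[OF smooth_weight c tangent_of_in[OF c]] tangent_of_comp[OF c] u_def[symmetric]
        using x \<beta>(2)[of i] by simp
    qed
    then have "g p (tangent_of c p x) (tangent_of c p x) = 0"
      unfolding metric_eq_sum_differentials[OF p tangent_of_in[OF c] tangent_of_in[OF c]] by simp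
    then have "x \<bullet> (gram c (coord c p) *v x) = 0"
      unfolding metric_eq_inner_gram[OF c tangent_of_in[OF c] tangent_of_in[OF c]] tangent_of_comp[OF c] .
    then show "x = 0" using gram_pos[OF c, of x] by fastforce
  qed
  obtain U V \<psi> where U: "open U" "U \<subseteq> ball u r" "u \<in> U" and V: "open V" "homeomorphism U V \<Psi> \<psi>" "smooth_on V \<psi>"
    using smooth_local_inverse[OF open_ball _ \<Psi>_smooth inj] r(1) by (metis centre_in_ball)
  have U_S: "U \<subseteq> coord c ` dom_of c" using U(2) r(2) unfolding S_def by blast
  define e where "e = (coord_inv c ` U, \<Psi> \<circ> coord c)"
  have e: "e \<in> A"
    unfolding e_def
    by (rule chart_reparametrize[OF c(1) U(1) U_S V(1,2) smooth_on_subset[OF \<Psi>_smooth U(2)] V(3)])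
  have dom_e: "q \<in> dom_of c" "coord c q \<in> U" if "q \<in> dom_of e" for q
    using that U_S coord_inv_in[OF ic] coord_coord_inv[OF ic] unfolding e_def by auto
  have coord_e: "coord e q $ i = \<beta> i * \<phi> i q" if "q \<in> dom_of e" for q i
    by (simp add: e_def \<Psi>_def coord_inv_coord[OF ic dom_e(1)[OF that]])
  show "\<exists>W \<rho>. openin T W \<and> p \<in> W \<and> smooth_fun_on A W \<rho> \<and> (\<forall>q\<in>W. \<rho> q > 0) \<and>
        flat_on A (\<lambda>q v w. \<rho> q * g q v w) W"
  proof (intro exI conjI)
    show "openin T (dom_of e)" by (rule openin_dom[OF e])
    have "coord_inv c u \<in> dom_of e" using U(3) by (simp add: e_def)
    then show "p \<in> dom_of e" unfolding u_def coord_inv_coord[OF ic c(2)] .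
    show "smooth_fun_on A (dom_of e) (grad_sq m)"
      unfolding smooth_fun_on_def
    proof
      fix d assume d: "d \<in> A"
      show "smooth_on (coord d ` (dom_of d \<inter> dom_of e)) (grad_sq m \<circ> coord_inv d)"
        using smooth_metric_gradients[OF smooth_weight smooth_weight d, of m m] unfolding grad_sq_def[abs_def]
        by (rule smooth_on_subset) blast
    qed
    show "\<forall>q\<in>dom_of e. grad_sq m q > 0" using grad_sq_pos dom_subset[OF e] by blast
    show "flat_on A (\<lambda>q v w. grad_sq m q * g q v w) (dom_of e)"
      unfolding flat_on_def
    proof (intro ballI bexI[OF _ e] conjI)
      fix q v w assume q: "q \<in> dom_of e" and v: "v \<in> tangent_space A q" and w: "w \<in> tangent_space A q"
      have qT: "q \<in> topspace T" using dom_subset[OF e] q by blast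
      have "grad_sq m q / grad_sq i q = \<kappa> i" for i
        using \<kappa>[of "coord c q" i] dom_e[OF q] U(2) unfolding coord_inv_coord[OF ic dom_e(1)[OF q]] by blast
      then have scale: "grad_sq m q / grad_sq i q = \<beta> i * \<beta> i" for i
        by (simp only: \<beta>(1))
      have comp: "z e $ i = \<beta> i * differential A (\<phi> i) q z" if "z \<in> tangent_space A q" for z i
        by (rule tangent_comp_coordinate[OF smooth_weight e q that coord_e])
      have "grad_sq m q * g q v w
          = (\<Sum>i\<in>UNIV. grad_sq m q / grad_sq i q * (differential A (\<phi> i) q v * differential A (\<phi> i) q w))"
        unfolding metric_eq_sum_differentials[OF qT v w] sum_distrib_left by (intro sum.cong refl) simp
      also have "\<dots> = v e \<bullet> w e"
        unfolding scale inner_vec_def inner_real_def comp[OF v] comp[OF w] by (intro sum.cong refl) algebra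
      finally show "grad_sq m q * g q v w = v e \<bullet> w e" .
    qed auto
  qed
qed

end

theorem corollary1p4:
  fixes T :: "'a topology"
    and A :: "('a, 'n::finite) chart set"
    and g :: "('a, 'n) metric"
  assumes "CARD('n) \<ge> 3"
    and "riemannian_manifold T A g"
    and "\<exists>\<phi> :: 'n \<Rightarrow> 'a \<Rightarrow> real. orthogonal_LCWs T A g \<phi>"
  shows "conformally_flat T A g"
proof -
  obtain \<phi> :: "'n \<Rightarrow> 'a \<Rightarrow> real" where "orthogonal_LCWs T A g \<phi>" using assms(3) by blast
  then interpret orthogonal_weights T A g \<phi>
    using assms(2) unfolding riemannian_manifold_def by unfold_locales blast+
  show ?thesis by (rule conformally_flat_if_weights)
qed

end
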